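(* Assume that $\ell=1$, let $a>0$, and let \[ \mu(t)=\log t+\log\log t-\log a \] for all large $t$. Let $p>0$. Then $\mathbb{E}D^p$ is finite if $p<a$ and infinite if $p>a$. Moreover, let $\mu'$ be another rate function and let $D'$ be the corresponding variable. If $\mu'(t)\le\mu(t)$ for all large $t$ and $p<a$, then $\mathbb{E}(D')^p<\infty$. If $\mu'(t)\ge\mu(t)$ for all large $t$ and $p>a$, then $\mathbb{E}(D')^p=\infty$.
   Context: Here $\ell=1$. $\mathcal N$ is an inhomogeneous Poisson point process on $(0,\infty)$ with rate function $\mu(t)$, i.e. with intensity measure $\mu(t)\,\mathrm{d}t$; write $M(a,b)=\int_a^b\mu(t)\,\mathrm{d}t$. It is assumed that $M(0,t)<\infty$ for every finite $t$ and that $\mu(t)>0$ for Lebesgue-almost all $t\ge 0$. Let $0<T_1<T_2<\cdots$ be the epochs (points) of $\mathcal N$, with $T_0=0$ by convention; if $\mathcal N$ has only finitely many points, say $n$ of them, then $T_{n+1}=\infty$. Define $D=\min\{T_n:\ n\ge 0,\ T_{n+1}-T_n\ge \ell\}$, with $D=\infty$ if there is no such $n$. The variable $D'$ is defined in the same way (same $\ell$) from an inhomogeneous Poisson process with rate function $\mu'$, where $\mu'$ satisfies the same assumptions ($\int_0^t\mu'(s)\,\mathrm{d}s<\infty$ for every finite $t$, $\mu'>0$ almost everywhere). *)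

theory Defs
  imports "HOL-Probability.Probability"
begin

text \<open>
  Rate functions live on \<open>(0,\<infinity>)\<close>; their values elsewhere are irrelevant. They are taken
  to be Borel measurable.
\<close>

definition intensity :: "(real \<Rightarrow> real) \<Rightarrow> real set \<Rightarrow> ennreal" where
  "intensity \<mu> A = (\<integral>\<^sup>+t\<in>A. ennreal (\<mu> t) \<partial>lborel)"

definition rate_function :: "(real \<Rightarrow> real) \<Rightarrow> bool" where
  "rate_function \<mu> \<longleftrightarrow>
     set_borel_measurable borel {0<..} \<mu> \<and>
     (\<forall>t>0. 0 \<le> \<mu> t) \<and>
     (\<forall>t>0. intensity \<mu> {0<..t} < \<infinity>) \<and>
     (AE t in lborel. 0 \<le> t \<longrightarrow> 0 < \<mu> t)"

text \<open>
  A Poisson process is a random locally finite set of points of \<open>(0,\<infinity>)\<close>; representing it by a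
  set is possible because the intensity measure has no atoms, so that there are no multiple points.
  Local finiteness means that every interval \<open>(0,t]\<close> contains finitely many points, so
  \<open>card\<close> below counts only finite sets.
\<close>

definition poisson_process ::
    "'w measure \<Rightarrow> ('w \<Rightarrow> real set) \<Rightarrow> (real \<Rightarrow> real) \<Rightarrow> bool" where
  "poisson_process P N \<mu> \<longleftrightarrow>
     prob_space P \<and>
     (\<forall>\<omega>\<in>space P. N \<omega> \<subseteq> {0<..} \<and> (\<forall>t. finite (N \<omega> \<inter> {..t}))) \<and>
     (\<forall>A. A \<in> sets borel \<and> A \<subseteq> {0<..} \<and> bounded A \<longrightarrow>
        (\<lambda>\<omega>. card (N \<omega> \<inter> A)) \<in> measurable P (count_space UNIV) \<and>
        (\<forall>k. measure P {\<omega> \<in> space P. card (N \<omega> \<inter> A) = k} =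
           enn2real (intensity \<mu> A) ^ k / fact k * exp (- enn2real (intensity \<mu> A)))) \<and>
     (\<forall>(n::nat) A. (\<forall>i<n. A i \<in> sets borel \<and> A i \<subseteq> {0<..} \<and> bounded (A i)) \<and>
        disjoint_family_on A {..<n} \<longrightarrow>
        prob_space.indep_vars P (\<lambda>_. count_space UNIV) (\<lambda>i \<omega>. card (N \<omega> \<inter> A i)) {..<n})"

text \<open>
  The epochs \<open>T\<^sub>n\<close> of a configuration \<open>S\<close>. If \<open>S\<close> has exactly \<open>n\<close> points, the infimum of the
  empty set gives \<open>T\<^sub>m = \<infinity>\<close> for all \<open>m > n\<close>.
\<close>

primrec epoch :: "real set \<Rightarrow> nat \<Rightarrow> ennreal" where
  "epoch S 0 = 0"
| "epoch S (Suc n) = Inf {ennreal x |x. x \<in> S \<and> epoch S n < ennreal x}"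

text \<open>
  The condition \<open>epoch S n < \<infinity>\<close> restricts attention to the \<open>T\<^sub>n\<close> that exist. For a locally finite
  \<open>S\<close> the infimum below is a minimum, unless the set is empty; then it is \<open>\<infinity>\<close>.
\<close>

definition first_gap :: "real \<Rightarrow> real set \<Rightarrow> ennreal" where
  "first_gap l S =
     Inf {epoch S n |n. epoch S n < \<infinity> \<and> epoch S (Suc n) - epoch S n \<ge> ennreal l}"

definition ennreal_powr :: "ennreal \<Rightarrow> real \<Rightarrow> ennreal" where
  "ennreal_powr x p = (if x = \<infinity> then \<infinity> else ennreal (enn2real x powr p))"

definition moment_D :: "real \<Rightarrow> 'w measure \<Rightarrow> ('w \<Rightarrow> real set) \<Rightarrow> real \<Rightarrow> ennreal" where
  "moment_D l P N p = (\<integral>\<^sup>+\<omega>. ennreal_powr (first_gap l (N \<omega>)) p \<partial>P)"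

end

theory Submission
  imports Defs "HOL-Real_Asymp.Real_Asymp"
begin

text \<open>
  Write \<open>D\<close> for the first gap with \<open>l = 1\<close>. If the window \<open>(u, u + 1)\<close> contains no point, then it lies
  in a gap between consecutive epochs which has length at least \<open>1\<close> and begins at or before \<open>u\<close>;
  so \<open>D\<close> is the least \<open>u \<ge> 0\<close> whose window \<open>(u, u + 1)\<close> is empty (\<open>first_gap_le\<close>, \<open>first_gap_ge\<close>).
  A long gap begins near time \<open>t\<close> when there is a point at \<open>t\<close> and none in \<open>(t, t + 1)\<close>. At the rate
  \<open>\<mu> t = ln t + ln (ln t) - ln a\<close> this happens with intensity about
  \<open>\<mu> t * exp (- \<mu> t) = \<mu> t * a / (t * ln t)\<close>, which is about \<open>a / t\<close>. Hence \<open>D\<close> exceeds \<open>t\<close> with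
  probability \<open>t powr (- a)\<close> up to factors \<open>t powr o(1)\<close>, and the moment of order \<open>p\<close> is finite for
  \<open>p < a\<close> and infinite for \<open>p > a\<close>.

  The tail of \<open>D\<close> is estimated on a grid of mesh \<open>h\<close> that starts at a large fixed time. Whether the
  cells of the grid contain points are independent events, and an empty window is a run of \<open>k\<close>
  consecutive empty cells: a run with \<open>k * h = 1\<close> is an empty window of length \<open>1\<close>, while every window
  of length \<open>1\<close> contains \<open>k\<close> whole cells if \<open>(k + 1) * h = 1\<close>. The probability that no such run
  occurs obeys a linear recursion in the number of remaining cells and the length of the current run
  (\<open>prob_no_run\<close>). Explicit super- and subsolutions of this recursion bound it from above and
  from below by a product with one factor per cell (\<open>survival_upper_bound\<close>,
  \<open>survival_lower_bound\<close>). These bounds need only one-sided estimates of the probabilities that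
  the cells are empty, so that a rate function which is merely bounded by the critical one for large
  times is covered without any coupling of two Poisson processes. The factors are close to
  \<open>1 - a * h / x\<close> at time \<open>x\<close>, and their product telescopes to a power of \<open>t\<close>.

  The mesh has to depend on the time \<open>t\<close> at which the tail is estimated: \<open>h\<close> must be small compared with
  \<open>1 / ln t\<close>, for otherwise a cell contains a point with a probability noticeably smaller than
  \<open>h * \<mu> t\<close>, and a window of length \<open>1 - h\<close> is empty with a probability noticeably larger than a window
  of length \<open>1\<close>.

  The tail bounds (\<open>first_gap_tail_upper\<close>, \<open>first_gap_tail_lower\<close>) concern events that contain, or are
  contained in, the event that \<open>D\<close> exceeds \<open>t\<close>, so that they make sense without knowing that \<open>D\<close> is
  measurable.
\<close>

section \<open>Runs of empty cells: the recursion and its super- and subsolutions\<close>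

definition geo :: "real \<Rightarrow> nat \<Rightarrow> real" where
  "geo s m = (\<Sum>l<m. s ^ l)"

lemma geo_Suc: "geo s (Suc m) = 1 + s * geo s m"
  unfolding geo_def by (subst sum.lessThan_Suc_shift) (simp add: sum_distrib_left)

lemma geo_mult: "(1 - s) * geo s m = 1 - s ^ m"
  unfolding geo_def using one_diff_power_eq[of s m] by simp

lemma geo_nonneg: "0 \<le> s \<Longrightarrow> 0 \<le> geo s m"
  unfolding geo_def by (intro sum_nonneg) auto

lemma geo_pos: "0 \<le> s \<Longrightarrow> 0 < m \<Longrightarrow> 0 < geo s m"
  by (cases m) (simp_all add: geo_Suc add_pos_nonneg geo_nonneg)

lemma geo_mono: "0 \<le> s \<Longrightarrow> m \<le> m' \<Longrightarrow> geo s m \<le> geo s m'"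
  unfolding geo_def by (intro sum_mono2) auto

lemma geo_mono_base: "0 \<le> s \<Longrightarrow> s \<le> s' \<Longrightarrow> geo s m \<le> geo s' m"
  unfolding geo_def by (intro sum_mono power_mono) auto

lemma geo_le: "0 \<le> s \<Longrightarrow> s \<le> 1 \<Longrightarrow> geo s m \<le> real m"
  unfolding geo_def using sum_mono[of "{..<m}" "\<lambda>l. s ^ l" "\<lambda>_. 1"] by (simp add: power_le_one)

text \<open>
  Without the products that occur on both sides, the claim compares sums over \<open>i < m \<le> j\<close> of
  \<open>s' ^ i * s ^ j\<close> and \<open>s ^ i * s' ^ j\<close>; the second has the larger exponent on the larger base.
\<close>
lemma geo_ratio_antimono:
  assumes "0 \<le> s" "s \<le> s'" "m \<le> k"
  shows "geo s' m * geo s k \<le> geo s m * geo s' k"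
proof -
  have split_at: "geo x k = geo x m + (\<Sum>l\<in>{m..<k}. x ^ l)" for x
    unfolding geo_def lessThan_atLeast0
    using sum.atLeastLessThan_concat[of 0 m k "\<lambda>l. x ^ l"] assms(3) by simp
  have "geo s' m * (\<Sum>l\<in>{m..<k}. s ^ l) \<le> geo s m * (\<Sum>l\<in>{m..<k}. s' ^ l)"
    unfolding geo_def sum_product
  proof (intro sum_mono)
    fix i j assume "i \<in> {..<m}" "j \<in> {m..<k}"
    then have "i \<le> j" by simp
    then obtain d where "j = i + d" by (rule le_Suc_ex[THEN exE])
    have "s ^ d \<le> s' ^ d" using assms by (intro power_mono) auto
    then have "s' ^ i * s ^ i * s ^ d \<le> s' ^ i * s ^ i * s' ^ d"
      using assms by (intro mult_left_mono) auto
    then show "s' ^ i * s ^ j \<le> s ^ i * s' ^ j"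
      using \<open>j = i + d\<close> by (simp add: power_add mult_ac)
  qed
  then show ?thesis unfolding split_at[of s] split_at[of s'] by (simp add: algebra_simps)
qed

text \<open>
  The probability that \<open>n\<close> independent cells, cell \<open>i\<close> being empty with probability \<open>r i\<close>, extend a
  current run of \<open>j\<close> empty cells without ever completing a run of \<open>k\<close> empty cells.
\<close>
primrec survival :: "nat \<Rightarrow> nat \<Rightarrow> (nat \<Rightarrow> real) \<Rightarrow> nat \<Rightarrow> real" where
  "survival k 0 r j = of_bool (j < k)"
| "survival k (Suc n) r j = of_bool (j < k) *
     ((1 - r 0) * survival k n (\<lambda>i. r (Suc i)) 0 + r 0 * survival k n (\<lambda>i. r (Suc i)) (Suc j))"

text \<open>
  Up to a factor, \<open>geo \<rho> (k - j)\<close> is \<open>1 - \<rho> ^ (k - j)\<close>, the probability that the current run is not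
  completed by the very next cells. If all cells are empty with probability \<open>\<rho>\<close>, one step of the
  recursion maps this function of \<open>j\<close> to itself minus \<open>\<rho> ^ k\<close>, which is a supersolution with factor
  \<open>1 - (1 - \<rho>) * \<rho> ^ k\<close> because \<open>(1 - \<rho>) * geo \<rho> m \<le> 1\<close>. The function decreases in \<open>j\<close>, so a larger
  probability \<open>r\<close> of an empty cell only lowers the mean; and it increases with \<open>\<rho>\<close>, so going back in
  time, along which \<open>\<rho>\<close> grows, preserves the bound.
\<close>
lemma survival_upper_bound:
  assumes "\<And>i. 0 \<le> \<rho> i" "\<And>i. \<rho> i \<le> r i" "\<And>i. r i \<le> 1" "\<And>i. \<rho> (Suc i) \<le> \<rho> i"
  shows "survival k n r j \<le> (\<Prod>i<n. 1 - (1 - \<rho> i) * \<rho> i ^ k) * geo (\<rho> 0) (k - j)"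
  using assms
proof (induction n arbitrary: \<rho> r j)
  case 0
  show ?case
  proof (cases "j < k")
    case True
    then have "geo (\<rho> 0) (k - j) = 1 + \<rho> 0 * geo (\<rho> 0) (k - Suc j)"
      by (metis Suc_diff_Suc geo_Suc)
    then show ?thesis using True 0 geo_nonneg by simp
  qed (simp add: geo_def)
next
  case (Suc n)
  define \<rho>' where "\<rho>' = (\<lambda>i. \<rho> (Suc i))"
  define q where "q = (\<lambda>i. 1 - (1 - \<rho> i) * \<rho> i ^ k)"
  define Q where "Q = (\<Prod>i<n. q (Suc i))"
  have \<rho>1: "\<rho> i \<le> 1" for i using order_trans[OF Suc.prems(2,3)] .
  have q0: "0 \<le> q i" for i
    unfolding q_def using mult_le_one[of "1 - \<rho> i" "\<rho> i ^ k"] Suc.prems(1)[of i] \<rho>1[of i]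
    by (simp add: power_le_one)
  then have Q0: "0 \<le> Q" unfolding Q_def by (intro prod_nonneg) auto
  have IH: "survival k n (\<lambda>i. r (Suc i)) j' \<le> Q * geo (\<rho> 0) (k - j')" for j'
  proof -
    have "survival k n (\<lambda>i. r (Suc i)) j' \<le> Q * geo (\<rho> (Suc 0)) (k - j')"
      unfolding Q_def q_def by (rule Suc.IH[of "\<lambda>i. \<rho> (Suc i)" "\<lambda>i. r (Suc i)"]) (use Suc.prems in auto)
    also have "\<dots> \<le> Q * geo (\<rho> 0) (k - j')"
      by (intro mult_left_mono geo_mono_base Q0) (use Suc.prems in auto)
    finally show ?thesis .
  qed
  have prod: "(\<Prod>i<Suc n. q i) = q 0 * Q"
    unfolding Q_def by (rule prod.lessThan_Suc_shift)
  show ?case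
  proof (cases "j < k")
    case False
    then show ?thesis
      by (auto simp: geo_def)
  next
    case True
    define g where "g = geo (\<rho> 0)"
    define m where "m = k - Suc j"
    have m: "k - j = Suc m" using True by (simp add: m_def)
    have r: "0 \<le> r 0" "r 0 \<le> 1" "\<rho> 0 \<le> r 0" "0 \<le> \<rho> 0"
      using Suc.prems(1-3)[of 0] by auto
    have mono: "g m \<le> g k" unfolding g_def m_def by (intro geo_mono r) auto
    have gm: "(1 - \<rho> 0) * g (Suc m) \<le> 1" unfolding g_def geo_mult using r by simp
    have gk: "(1 - \<rho> 0) * g k = 1 - \<rho> 0 ^ k" unfolding g_def geo_mult ..
    have gs: "g (Suc m) = 1 + \<rho> 0 * g m" unfolding g_def by (rule geo_Suc)
    have "survival k (Suc n) r j = (1 - r 0) * survival k n (\<lambda>i. r (Suc i)) 0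
        + r 0 * survival k n (\<lambda>i. r (Suc i)) (Suc j)" using True by simp
    also have "\<dots> \<le> (1 - r 0) * (Q * g k) + r 0 * (Q * g m)"
      using IH[of 0] IH[of "Suc j"] r unfolding g_def m_def
      by (intro add_mono mult_left_mono) auto
    also have "\<dots> = Q * (g k - r 0 * (g k - g m))" by (simp add: algebra_simps)
    also have "\<dots> \<le> Q * (g k - \<rho> 0 * (g k - g m))"
      using mono r Q0 by (intro mult_left_mono diff_left_mono mult_right_mono) auto
    also have "g k - \<rho> 0 * (g k - g m) = g (Suc m) - \<rho> 0 ^ k"
      using gk gs by (simp add: algebra_simps)
    also have "\<dots> \<le> q 0 * g (Suc m)"
      using mult_left_mono[OF gm, of "\<rho> 0 ^ k"] r unfolding q_def by (simp add: algebra_simps)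
    finally have "survival k (Suc n) r j \<le> Q * (q 0 * g (Suc m))" using Q0 by (simp add: mult_left_mono)
    then show ?thesis using prod m unfolding q_def g_def by (simp only: mult_ac)
  qed
qed

text \<open>
  Let \<open>q = geo s k / geo s (Suc k)\<close>. For cells that are empty with probability exactly \<open>s * q\<close>, the
  function \<open>geo s (k - j) / geo s k\<close> of \<open>j\<close> is an eigenfunction of the recursion with eigenvalue \<open>q\<close>.
  It decreases in \<open>j\<close>, so smaller probabilities of an empty cell are harmless, and it decreases in \<open>s\<close> by
  \<open>geo_ratio_antimono\<close>, so \<open>s\<close> may vary as long as it does not increase with time.
\<close>
lemma survival_lower_bound:
  assumes "\<And>i. 0 \<le> s i" "\<And>i. s (Suc i) \<le> s i" "\<And>i. 0 \<le> r i" "\<And>i. r i \<le> 1"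
    "\<And>i. i < n \<Longrightarrow> r i \<le> s i * (geo (s i) k / geo (s i) (Suc k))" "0 < k"
  shows "(\<Prod>i<n. geo (s i) k / geo (s i) (Suc k)) * (geo (s 0) (k - j) / geo (s 0) k)
           \<le> survival k n r j"
  using assms(1-5)
proof (induction n arbitrary: s r j)
  case 0
  have "geo (s 0) (k - j) / geo (s 0) k \<le> 1"
    using geo_mono[of "s 0" "k - j" k] geo_pos[of "s 0" k] 0 assms(6) by simp
  then show ?case by (auto simp: geo_def)
next
  case (Suc n)
  define q where "q = (\<lambda>i. geo (s i) k / geo (s i) (Suc k))"
  define Q where "Q = (\<Prod>i<n. q (Suc i))"
  define g where "g = geo (s 0)"
  have pos: "0 < geo (s i) k" for i using geo_pos assms(6) Suc.prems(1) by auto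
  have q0: "0 \<le> q i" for i
    unfolding q_def using Suc.prems(1) geo_nonneg by auto
  then have Q0: "0 \<le> Q" unfolding Q_def by (intro prod_nonneg) auto
  have IH: "Q * (g (k - j') / g k) \<le> survival k n (\<lambda>i. r (Suc i)) j'" for j'
  proof -
    have "g (k - j') / g k \<le> geo (s (Suc 0)) (k - j') / geo (s (Suc 0)) k"
      using geo_ratio_antimono[of "s (Suc 0)" "s 0" "k - j'" k] Suc.prems pos
      unfolding g_def by (simp add: divide_simps mult.commute)
    then have "Q * (g (k - j') / g k) \<le> Q * (geo (s (Suc 0)) (k - j') / geo (s (Suc 0)) k)"
      by (rule mult_left_mono[OF _ Q0])
    also have "\<dots> \<le> survival k n (\<lambda>i. r (Suc i)) j'"
      unfolding Q_def q_def by (rule Suc.IH[of "\<lambda>i. s (Suc i)" "\<lambda>i. r (Suc i)"]) (use Suc.prems in auto)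
    finally show ?thesis .
  qed
  have prod: "(\<Prod>i<Suc n. q i) = q 0 * Q"
    unfolding Q_def by (rule prod.lessThan_Suc_shift)
  show ?case
  proof (cases "j < k")
    case False
    then show ?thesis by (simp add: geo_def)
  next
    case True
    define m where "m = k - Suc j"
    have m: "k - j = Suc m" using True by (simp add: m_def)
    have r: "0 \<le> r 0" "r 0 \<le> 1" "r 0 \<le> s 0 * q 0" "0 \<le> s 0"
      using Suc.prems(1,3,4)[of 0] Suc.prems(5)[of 0] unfolding q_def by auto
    have gk: "0 < g k" unfolding g_def by (rule pos)
    have mono: "g m \<le> g k" unfolding g_def m_def by (intro geo_mono r) auto
    have gs: "g (Suc m) = 1 + s 0 * g m" "g (Suc k) = 1 + s 0 * g k" unfolding g_def by (rule geo_Suc)+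
    have "g (Suc k) > 0" unfolding g_def using r geo_pos by blast
    then have q: "q 0 * g (Suc k) = g k" unfolding q_def g_def by simp
    have "q 0 * g (Suc m) = g k - q 0 * (g (Suc k) - g (Suc m))" using q by (simp add: algebra_simps)
    also have "\<dots> = g k - s 0 * q 0 * (g k - g m)" unfolding gs by (simp add: algebra_simps)
    also have "\<dots> \<le> g k - r 0 * (g k - g m)"
      using mono r by (intro diff_left_mono mult_right_mono) auto
    finally have "q 0 * g (Suc m) \<le> (1 - r 0) * g k + r 0 * g m" by (simp add: algebra_simps)
    then have "Q / g k * (q 0 * g (Suc m)) \<le> Q / g k * ((1 - r 0) * g k + r 0 * g m)"
      using Q0 gk by (intro mult_left_mono) auto
    also have "\<dots> = (1 - r 0) * (Q * (g k / g k)) + r 0 * (Q * (g m / g k))"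
      by (simp add: algebra_simps)
    also have "\<dots> \<le> (1 - r 0) * survival k n (\<lambda>i. r (Suc i)) 0
        + r 0 * survival k n (\<lambda>i. r (Suc i)) (Suc j)"
      using IH[of 0] IH[of "Suc j"] r unfolding m_def
      by (intro add_mono mult_left_mono) auto
    also have "\<dots> = survival k (Suc n) r j" using True by simp
    finally show ?thesis using prod m unfolding q_def g_def
      by (simp add: mult_ac del: survival.simps prod.lessThan_Suc)
  qed
qed

text \<open>
  Here \<open>x i\<close> means that cell \<open>i\<close> is occupied, and \<open>j\<close> counts the empty cells just before cell \<open>0\<close>.
\<close>
primrec no_run :: "nat \<Rightarrow> nat \<Rightarrow> (nat \<Rightarrow> bool) \<Rightarrow> nat \<Rightarrow> bool" where
  "no_run k 0 x j = (j < k)"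
| "no_run k (Suc n) x j = (j < k \<and> no_run k n (\<lambda>i. x (Suc i)) (if x 0 then 0 else Suc j))"

lemma no_run_cong: "(\<And>i. i < n \<Longrightarrow> x i = y i) \<Longrightarrow> no_run k n x j = no_run k n y j"
proof (induction n arbitrary: x y j)
  case (Suc n)
  have "no_run k n (\<lambda>i. x (Suc i)) j' = no_run k n (\<lambda>i. y (Suc i)) j'" for j'
    by (rule Suc.IH) (use Suc.prems in auto)
  then show ?case using Suc.prems[of 0] by auto
qed simp

lemma no_run_initial:
  "no_run k n x j \<Longrightarrow> k \<le> n + j \<Longrightarrow> \<exists>l. l + j < k \<and> x l"
proof (induction n arbitrary: x j)
  case (Suc n)
  show ?case
  proof (cases "x 0")
    case True then show ?thesis using Suc.prems by (intro exI[of _ 0]) auto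
  next
    case False
    then have "\<exists>l. l + Suc j < k \<and> x (Suc l)"
      using Suc.prems by (intro Suc.IH[of "\<lambda>i. x (Suc i)"]) auto
    then show ?thesis by force
  qed
qed simp

lemma no_run_window:
  "no_run k n x j \<Longrightarrow> i + k \<le> n \<Longrightarrow> \<exists>l<k. x (i + l)"
proof (induction i arbitrary: n x j)
  case 0
  then obtain l where "l + j < k" "x l" using no_run_initial[of k n x j] by auto
  then show ?case by (intro exI[of _ l]) auto
next
  case (Suc i)
  then obtain n' where n': "n = Suc n'" by (cases n) auto
  show ?case using Suc.IH[of n' "\<lambda>i. x (Suc i)"] Suc.prems unfolding n' by auto
qed

lemma not_no_run:
  "\<not> no_run k n x j \<Longrightarrow> (\<exists>m\<le>n. k \<le> j + m \<and> (\<forall>l<m. \<not> x l)) \<or> (\<exists>i. i + k \<le> n \<and> (\<forall>l<k. \<not> x (i + l)))"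
proof (induction n arbitrary: x j)
  case (Suc n)
  let ?j = "if x 0 then 0 else Suc j"
  show ?case
  proof (cases "j < k")
    case True
    then have "\<not> no_run k n (\<lambda>i. x (Suc i)) ?j" using Suc.prems by simp
    from Suc.IH[OF this] show ?thesis
    proof (elim disjE exE conjE)
      fix m assume m: "m \<le> n" "k \<le> ?j + m" "\<forall>l<m. \<not> x (Suc l)"
      show ?thesis
      proof (cases "x 0")
        case True
        then show ?thesis using m by (intro disjI2 exI[of _ 1]) auto
      next
        case False
        then show ?thesis using m
          by (intro disjI1 exI[of _ "Suc m"]) (auto simp: less_Suc_eq_0_disj)
      qed
    next
      fix i assume "i + k \<le> n" "\<forall>l<k. \<not> x (Suc (i + l))"
      then show ?thesis by (intro disjI2 exI[of _ "Suc i"]) auto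
    qed
  qed auto
qed auto

lemma not_no_run_zero:
  assumes "\<not> no_run k n x 0"
  obtains i where "i + k \<le> n" "\<forall>l<k. \<not> x (i + l)"
proof -
  from not_no_run[OF assms] consider m where "m \<le> n" "k \<le> m" "\<forall>l<m. \<not> x l"
    | i where "i + k \<le> n" "\<forall>l<k. \<not> x (i + l)" by auto
  then show ?thesis by cases (auto intro: that[of 0] that)
qed

section \<open>Independent cells\<close>

context prob_space
begin

text \<open>
  A predicate that depends on finitely many Boolean coordinates is an event of a finite product of
  discrete spaces, so independence of the coordinates applies to it directly.
\<close>
lemma prob_first_and_rest:
  fixes X :: "nat \<Rightarrow> 'a \<Rightarrow> bool"
  assumes ind: "indep_vars (\<lambda>_. count_space UNIV) X {..<Suc n}"
    and Q: "\<And>x y. (\<And>i. i < n \<Longrightarrow> x i = y i) \<Longrightarrow> Q x = Q y"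
  shows "{\<omega> \<in> space M. Q (\<lambda>i. X (Suc i) \<omega>)} \<in> events"
    and "{\<omega> \<in> space M. X 0 \<omega> = b} \<in> events"
    and "prob {\<omega> \<in> space M. X 0 \<omega> = b \<and> Q (\<lambda>i. X (Suc i) \<omega>)} =
         prob {\<omega> \<in> space M. X 0 \<omega> = b} * prob {\<omega> \<in> space M. Q (\<lambda>i. X (Suc i) \<omega>)}"
proof -
  let ?I = "Suc ` {..<n}"
  have "indep_var (PiM {0} (\<lambda>_. count_space UNIV)) (\<lambda>\<omega>. restrict (\<lambda>i. X i \<omega>) {0})
          (PiM ?I (\<lambda>_. count_space UNIV)) (\<lambda>\<omega>. restrict (\<lambda>i. X i \<omega>) ?I)"
    by (rule indep_var_restrict[OF ind]) auto
  then have iv: "indep_var (count_space (PiE {0} (\<lambda>_. UNIV))) (\<lambda>\<omega>. restrict (\<lambda>i. X i \<omega>) {0})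
          (count_space (PiE ?I (\<lambda>_. UNIV))) (\<lambda>\<omega>. restrict (\<lambda>i. X i \<omega>) ?I)"
    by (simp add: count_space_PiM_finite)
  let ?A = "{f \<in> PiE {0} (\<lambda>_. UNIV). f 0 = b}"
  let ?B = "{f \<in> PiE ?I (\<lambda>_. UNIV). Q (\<lambda>i. f (Suc i))}"
  have Qr: "Q (\<lambda>i. restrict (\<lambda>i. X i \<omega>) ?I (Suc i)) = Q (\<lambda>i. X (Suc i) \<omega>)" for \<omega>
    by (rule Q) auto
  have A: "(\<lambda>\<omega>. restrict (\<lambda>i. X i \<omega>) {0}) -` ?A \<inter> space M = {\<omega> \<in> space M. X 0 \<omega> = b}"
    by auto
  have B: "(\<lambda>\<omega>. restrict (\<lambda>i. X i \<omega>) ?I) -` ?B \<inter> space M = {\<omega> \<in> space M. Q (\<lambda>i. X (Suc i) \<omega>)}"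
    using Qr by (auto simp: restrict_PiE_iff)
  have AB: "(\<lambda>\<omega>. (restrict (\<lambda>i. X i \<omega>) {0}, restrict (\<lambda>i. X i \<omega>) ?I)) -` (?A \<times> ?B) \<inter> space M =
      {\<omega> \<in> space M. X 0 \<omega> = b \<and> Q (\<lambda>i. X (Suc i) \<omega>)}"
  proof -
    have "(\<lambda>\<omega>. (restrict (\<lambda>i. X i \<omega>) {0}, restrict (\<lambda>i. X i \<omega>) ?I)) -` (?A \<times> ?B) \<inter> space M =
       ((\<lambda>\<omega>. restrict (\<lambda>i. X i \<omega>) {0}) -` ?A \<inter> space M) \<inter>
       ((\<lambda>\<omega>. restrict (\<lambda>i. X i \<omega>) ?I) -` ?B \<inter> space M)"
      by (auto simp only: vimage_def mem_Collect_eq mem_Times_iff fst_conv snd_conv Int_iff)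
    then show ?thesis unfolding A B by auto
  qed
  show "prob {\<omega> \<in> space M. X 0 \<omega> = b \<and> Q (\<lambda>i. X (Suc i) \<omega>)} =
         prob {\<omega> \<in> space M. X 0 \<omega> = b} * prob {\<omega> \<in> space M. Q (\<lambda>i. X (Suc i) \<omega>)}"
    using indep_varD[OF iv, of ?A ?B] unfolding A B AB by auto
  show "{\<omega> \<in> space M. Q (\<lambda>i. X (Suc i) \<omega>)} \<in> events"
    using measurable_sets[OF indep_var_rv2[OF iv], of ?B] unfolding B by auto
  show "{\<omega> \<in> space M. X 0 \<omega> = b} \<in> events"
    using measurable_sets[OF indep_var_rv1[OF iv], of ?A] unfolding A by auto
qed

lemma indep_vars_Suc_shift:
  assumes "indep_vars (\<lambda>_. N) X {..<Suc n}"
  shows "indep_vars (\<lambda>_. N) (\<lambda>i. X (Suc i)) {..<n}"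
proof -
  define F where "F = (\<lambda>i. {X i -` A \<inter> space M |A. A \<in> sets N})"
  have rv: "random_variable N (X i)" if "i < Suc n" for i
    using assms that unfolding indep_vars_def2 by auto
  have ind: "indep_sets F {..<Suc n}" using assms unfolding indep_vars_def2 F_def by simp
  have "indep_sets (\<lambda>i. F (Suc i)) {..<n}"
  proof (rule indep_setsI)
    fix i assume "i \<in> {..<n}"
    then show "F (Suc i) \<subseteq> events" using rv[of "Suc i"] unfolding F_def by auto
  next
    fix A :: "nat \<Rightarrow> 'a set" and J assume J: "J \<noteq> {}" "J \<subseteq> {..<n}" "finite J" "\<forall>j\<in>J. A j \<in> F (Suc j)"
    then have "prob (\<Inter>j\<in>Suc ` J. A (j - 1)) = (\<Prod>j\<in>Suc ` J. prob (A (j - 1)))"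
      by (intro indep_setsD[OF ind]) auto
    then show "prob (\<Inter>j\<in>J. A j) = (\<Prod>j\<in>J. prob (A j))"
      by (simp add: prod.reindex)
  qed
  then show ?thesis using rv unfolding indep_vars_def2 F_def by auto
qed

lemma prob_no_run:
  fixes X :: "nat \<Rightarrow> 'a \<Rightarrow> bool"
  assumes "indep_vars (\<lambda>_. count_space UNIV) X {..<n}"
    and "\<And>i. i < n \<Longrightarrow> prob {\<omega> \<in> space M. \<not> X i \<omega>} = r i"
  shows "{\<omega> \<in> space M. no_run k n (\<lambda>i. X i \<omega>) j} \<in> events \<and>
         prob {\<omega> \<in> space M. no_run k n (\<lambda>i. X i \<omega>) j} = survival k n r j"
  using assms
proof (induction n arbitrary: X r j)
  case 0
  then show ?case by (cases "j < k") (auto simp: prob_space)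
next
  case (Suc n)
  define F where "F = (\<lambda>j'. {\<omega> \<in> space M. no_run k n (\<lambda>i. X (Suc i) \<omega>) j'})"
  have IH: "F j' \<in> events" "prob (F j') = survival k n (\<lambda>i. r (Suc i)) j'" for j'
    using Suc.IH[OF indep_vars_Suc_shift[OF Suc.prems(1)], of "\<lambda>i. r (Suc i)" j'] Suc.prems(2)
    unfolding F_def by auto
  have cong: "no_run k n x j' = no_run k n y j'" if "\<And>i. i < n \<Longrightarrow> x i = y i" for x y j'
    by (rule no_run_cong) (rule that)
  note step = prob_first_and_rest[where Q = "\<lambda>x. no_run k n x j'" for j', OF Suc.prems(1) cong]
  define G where "G = (\<lambda>b. {\<omega> \<in> space M. X 0 \<omega> = b})"
  have G: "G b \<in> events" for b unfolding G_def by (rule step(2))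
  have GF: "prob (G b \<inter> F j') = prob (G b) * prob (F j')" for b j'
  proof -
    have "G b \<inter> F j' = {\<omega> \<in> space M. X 0 \<omega> = b \<and> no_run k n (\<lambda>i. X (Suc i) \<omega>) j'}"
      unfolding G_def F_def by auto
    then show ?thesis using step(3)[of b j'] unfolding G_def F_def by simp
  qed
  have rF: "prob (G False) = r 0" using Suc.prems(2)[of 0] unfolding G_def by simp
  have "G True = space M - G False" unfolding G_def by auto
  then have rT: "prob (G True) = 1 - r 0" using prob_compl[OF G[of False]] rF by simp
  show ?case
  proof (cases "j < k")
    case False
    then show ?thesis by auto
  next
    case True
    have eq: "{\<omega> \<in> space M. no_run k (Suc n) (\<lambda>i. X i \<omega>) j} =
        (G True \<inter> F 0) \<union> (G False \<inter> F (Suc j))"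
      using True unfolding G_def F_def by auto
    have disj: "(G True \<inter> F 0) \<inter> (G False \<inter> F (Suc j)) = {}" unfolding G_def by auto
    have "prob ((G True \<inter> F 0) \<union> (G False \<inter> F (Suc j))) =
        prob (G True \<inter> F 0) + prob (G False \<inter> F (Suc j))"
      using G IH(1) by (intro finite_measure_Union sets.Int disj)
    then have "prob ((G True \<inter> F 0) \<union> (G False \<inter> F (Suc j))) = survival k (Suc n) r j"
      unfolding GF IH(2) rF rT using True by simp
    moreover have "(G True \<inter> F 0) \<union> (G False \<inter> F (Suc j)) \<in> events"
      using G IH(1) by (intro sets.Un sets.Int)
    ultimately show ?thesis unfolding eq by simp
  qed
qed

text \<open>
  The additional first \<open>m\<close> cells serve to exclude gaps during an initial period, in which nothing is
  known about the rate except that it is positive.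
\<close>
lemma prob_all_and_no_run:
  fixes X :: "nat \<Rightarrow> 'a \<Rightarrow> bool"
  assumes "indep_vars (\<lambda>_. count_space UNIV) X {..<m + n}"
    and "\<And>i. i < m + n \<Longrightarrow> prob {\<omega> \<in> space M. \<not> X i \<omega>} = r i"
  shows "{\<omega> \<in> space M. (\<forall>i<m. X i \<omega>) \<and> no_run k n (\<lambda>i. X (m + i) \<omega>) j} \<in> events \<and>
         prob {\<omega> \<in> space M. (\<forall>i<m. X i \<omega>) \<and> no_run k n (\<lambda>i. X (m + i) \<omega>) j} =
           (\<Prod>i<m. 1 - r i) * survival k n (\<lambda>i. r (m + i)) j"
  using assms
proof (induction m arbitrary: X r)
  case 0
  then show ?case using prob_no_run[where n = n and X = X and r = r and k = k and j = j] by simp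
next
  case (Suc m)
  have ind: "indep_vars (\<lambda>_. count_space UNIV) X {..<Suc (m + n)}" using Suc.prems(1) by simp
  define Q where "Q = (\<lambda>x. (\<forall>i<m. x i) \<and> no_run k n (\<lambda>i. x (m + i)) j)"
  have Q: "Q x = Q y" if "\<And>i. i < m + n \<Longrightarrow> x i = y i" for x y
  proof -
    have "no_run k n (\<lambda>i. x (m + i)) j = no_run k n (\<lambda>i. y (m + i)) j"
      by (rule no_run_cong) (use that in auto)
    then show ?thesis using that unfolding Q_def by auto
  qed
  have pr: "prob {\<omega> \<in> space M. \<not> X (Suc i) \<omega>} = r (Suc i)" if "i < m + n" for i
    using Suc.prems(2)[of "Suc i"] that by simp
  have IH: "prob {\<omega> \<in> space M. Q (\<lambda>i. X (Suc i) \<omega>)} =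
      (\<Prod>i<m. 1 - r (Suc i)) * survival k n (\<lambda>i. r (Suc m + i)) j"
    using conjunct2[OF Suc.IH[OF indep_vars_Suc_shift[OF ind] pr]] unfolding Q_def by simp
  note step = prob_first_and_rest[OF ind, of Q, OF Q]
  have eq: "{\<omega> \<in> space M. (\<forall>i<Suc m. X i \<omega>) \<and> no_run k n (\<lambda>i. X (Suc m + i) \<omega>) j} =
      {\<omega> \<in> space M. X 0 \<omega> = True \<and> Q (\<lambda>i. X (Suc i) \<omega>)}"
    unfolding Q_def by (auto simp: All_less_Suc2)
  have "{\<omega> \<in> space M. X 0 \<omega> = True} = space M - {\<omega> \<in> space M. X 0 \<omega> = False}" by auto
  then have r0: "prob {\<omega> \<in> space M. X 0 \<omega> = True} = 1 - r 0"
    using prob_compl[OF step(2)[of False]] Suc.prems(2)[of 0] by simp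
  have "prob {\<omega> \<in> space M. X 0 \<omega> = True \<and> Q (\<lambda>i. X (Suc i) \<omega>)} =
      (1 - r 0) * ((\<Prod>i<m. 1 - r (Suc i)) * survival k n (\<lambda>i. r (Suc m + i)) j)"
    by (rule trans[OF step(3) arg_cong2[where f = "(*)", OF r0 IH]])
  moreover have "(\<Prod>i<Suc m. 1 - r i) = (1 - r 0) * (\<Prod>i<m. 1 - r (Suc i))"
    by (rule prod.lessThan_Suc_shift)
  moreover have "{\<omega> \<in> space M. X 0 \<omega> = True \<and> Q (\<lambda>i. X (Suc i) \<omega>)} \<in> events"
  proof -
    have "{\<omega> \<in> space M. X 0 \<omega> = True \<and> Q (\<lambda>i. X (Suc i) \<omega>)} =
        {\<omega> \<in> space M. X 0 \<omega> = True} \<inter> {\<omega> \<in> space M. Q (\<lambda>i. X (Suc i) \<omega>)}" by auto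
    then show ?thesis using sets.Int[OF step(2)[of True] step(1)] by (simp only:)
  qed
  ultimately show ?case unfolding eq by (simp only: mult.assoc simp_thms)
qed

end

section \<open>The first gap as the first empty window\<close>

text \<open>
  By local finiteness there is a last epoch not exceeding \<open>u\<close>, since the epochs strictly increase as
  long as they stay below \<open>u\<close>. The epoch after it is beyond \<open>u\<close>, hence beyond the empty window.
\<close>
lemma first_gap_le:
  assumes fin: "finite (S \<inter> {..u})" and u: "0 \<le> u"
    and gap: "S \<inter> {u<..<u + l} = {}" and l: "0 < l"
  shows "first_gap l S \<le> ennreal u"
proof -
  let ?far = "\<lambda>n. ennreal (u + l) \<le> epoch S (Suc n)"
  have step: "?far n \<or> (epoch S n < epoch S (Suc n) \<and> epoch S (Suc n) \<in> ennreal ` (S \<inter> {..u}))"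
    if le: "epoch S n \<le> ennreal u" for n
  proof -
    define B where "B = {x \<in> S. epoch S n < ennreal x \<and> x \<le> u}"
    have finB: "finite B" unfolding B_def by (rule finite_subset[OF _ fin]) auto
    show ?thesis
    proof (cases "B = {}")
      case True
      have "ennreal (u + l) \<le> ennreal x" if "x \<in> S" "epoch S n < ennreal x" for x
      proof -
        have "\<not> x \<le> u" using that True unfolding B_def by auto
        then show ?thesis using gap that(1) by (intro ennreal_leI) force
      qed
      then have "?far n" by (auto intro!: Inf_greatest)
      then show ?thesis ..
    next
      case False
      have mem: "Min B \<in> B" using finB False by (rule Min_in)
      have "epoch S (Suc n) = ennreal (Min B)"
        unfolding epoch.simps
      proof (rule antisym)
        show "Inf {ennreal x |x. x \<in> S \<and> epoch S n < ennreal x} \<le> ennreal (Min B)"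
          using mem unfolding B_def by (intro Inf_lower) auto
        show "ennreal (Min B) \<le> Inf {ennreal x |x. x \<in> S \<and> epoch S n < ennreal x}"
        proof (rule Inf_greatest, clarify)
          fix x assume x: "x \<in> S" "epoch S n < ennreal x"
          have "Min B \<le> x"
          proof (cases "x \<le> u")
            case True
            then show ?thesis using x finB by (intro Min_le) (auto simp: B_def)
          next
            case False
            then show ?thesis using mem unfolding B_def by auto
          qed
          then show "ennreal (Min B) \<le> ennreal x" by (rule ennreal_leI)
        qed
      qed
      then show ?thesis using mem unfolding B_def by auto
    qed
  qed
  have "\<exists>n. epoch S n \<le> ennreal u \<and> ?far n"
  proof (rule ccontr)
    assume none: "\<nexists>n. epoch S n \<le> ennreal u \<and> ?far n"
    have le: "epoch S n \<le> ennreal u" for n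
    proof (induction n)
      case (Suc n)
      then have "epoch S (Suc n) \<in> ennreal ` (S \<inter> {..u})" using step[of n] none by blast
      then show ?case by (auto intro: ennreal_leI simp del: epoch.simps)
    qed simp
    then have *: "epoch S n < epoch S (Suc n)" "epoch S (Suc n) \<in> ennreal ` (S \<inter> {..u})" for n
      using step[OF le, of n] none by blast+
    have "strict_mono (epoch S)" using *(1) by (simp add: strict_mono_Suc_iff del: epoch.simps)
    then have "inj (\<lambda>n. epoch S (Suc n))"
      by (intro injI) (metis nat.inject strict_mono_eq)
    then have "infinite (range (\<lambda>n. epoch S (Suc n)))" by (rule range_inj_infinite)
    moreover have "range (\<lambda>n. epoch S (Suc n)) \<subseteq> ennreal ` (S \<inter> {..u})" using *(2) by blast
    ultimately show False using fin finite_surj by blast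
  qed
  then obtain n where n: "epoch S n \<le> ennreal u" "ennreal (u + l) \<le> epoch S (Suc n)" by blast
  have "ennreal l = ennreal (u + l) - ennreal u"
    using u l by (subst ennreal_minus) auto
  also have "\<dots> \<le> epoch S (Suc n) - epoch S n"
    using n(2,1) by (rule ennreal_minus_mono)
  finally have "first_gap l S \<le> epoch S n"
    unfolding first_gap_def using n(1)
    by (intro Inf_lower) (auto simp del: epoch.simps simp: le_less_trans[OF _ ennreal_less_top])
  then show ?thesis using n(1) by simp
qed

lemma first_gap_ge:
  assumes l: "0 < l"
    and hit: "\<And>u. 0 \<le> u \<Longrightarrow> u < v \<Longrightarrow> S \<inter> {u<..<u + l} \<noteq> {}"
  shows "ennreal v \<le> first_gap l S"
  unfolding first_gap_def
proof (rule Inf_greatest, clarify)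
  fix n assume n: "epoch S n < \<infinity>" "ennreal l \<le> epoch S (Suc n) - epoch S n"
  show "ennreal v \<le> epoch S n"
  proof (rule ccontr)
    assume "\<not> ennreal v \<le> epoch S n"
    moreover obtain u where u: "0 \<le> u" "epoch S n = ennreal u"
      using n(1) by (cases "epoch S n") auto
    ultimately have "u < v" using ennreal_leI not_le by metis
    then obtain x where x: "x \<in> S" "u < x" "x < u + l" using hit u(1) by fastforce
    have "epoch S (Suc n) \<le> ennreal x"
      unfolding epoch.simps u using x u(1) by (intro Inf_lower) (auto simp: ennreal_less_iff)
    then have "epoch S (Suc n) - epoch S n \<le> ennreal x - ennreal u"
      unfolding u by (rule ennreal_minus_mono) simp
    also have "\<dots> = ennreal (x - u)" using u(1) by (simp add: ennreal_minus)
    also have "\<dots> < ennreal l" using x u(1) by (intro ennreal_lessI) auto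
    finally show False using n(2) by simp
  qed
qed

section \<open>Poisson processes on a grid\<close>

lemma intensity_mono: "A \<subseteq> B \<Longrightarrow> intensity \<mu> A \<le> intensity \<mu> B"
  unfolding intensity_def by (intro nn_integral_mono) (auto split: split_indicator)

lemma intensity_Ioc_finite:
  assumes "rate_function \<mu>" "0 \<le> x"
  shows "intensity \<mu> {x<..y} < \<infinity>"
proof (cases "0 < y")
  case True
  then have "intensity \<mu> {0<..y} < \<infinity>" using assms(1) unfolding rate_function_def by auto
  moreover have "intensity \<mu> {x<..y} \<le> intensity \<mu> {0<..y}"
    using assms(2) by (intro intensity_mono) auto
  ultimately show ?thesis by (rule le_less_trans[rotated])
next
  case False
  then have "{x<..y} = {}" using assms(2) by auto
  then show ?thesis by (simp add: intensity_def)
qed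

lemma intensity_Ioc_le:
  assumes "x \<le> y" "0 \<le> c" "\<And>t. x < t \<Longrightarrow> t \<le> y \<Longrightarrow> \<mu> t \<le> c"
  shows "enn2real (intensity \<mu> {x<..y}) \<le> c * (y - x)"
proof -
  have "intensity \<mu> {x<..y} \<le> (\<integral>\<^sup>+t. ennreal c * indicator {x<..y} t \<partial>lborel)"
    unfolding intensity_def using assms(3)
    by (intro nn_integral_mono) (auto split: split_indicator intro: ennreal_leI)
  also have "\<dots> = ennreal (c * (y - x))"
    using assms(1,2) by (simp add: nn_integral_cmult_indicator ennreal_mult)
  finally show ?thesis
    using assms(1,2) by (intro enn2real_leI) auto
qed

lemma intensity_Ioc_ge:
  assumes "rate_function \<mu>" "0 \<le> x" "x \<le> y" "0 \<le> c" "\<And>t. x < t \<Longrightarrow> t \<le> y \<Longrightarrow> c \<le> \<mu> t"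
  shows "c * (y - x) \<le> enn2real (intensity \<mu> {x<..y})"
proof -
  have "ennreal (c * (y - x)) = (\<integral>\<^sup>+t. ennreal c * indicator {x<..y} t \<partial>lborel)"
    using assms(3,4) by (simp add: nn_integral_cmult_indicator ennreal_mult)
  also have "\<dots> \<le> intensity \<mu> {x<..y}"
    unfolding intensity_def using assms(5)
    by (intro nn_integral_mono) (auto split: split_indicator intro: ennreal_leI)
  finally have "enn2real (ennreal (c * (y - x))) \<le> enn2real (intensity \<mu> {x<..y})"
    using intensity_Ioc_finite[OF assms(1,2)] by (intro enn2real_mono) auto
  then show ?thesis using assms(3,4) by simp
qed

text \<open>
  This is where the rate being positive almost everywhere enters: every cell of the initial period is
  occupied with positive probability.
\<close>
lemma intensity_Ioc_pos:
  assumes "rate_function \<mu>" "0 \<le> x" "x < y"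
  shows "0 < enn2real (intensity \<mu> {x<..y})"
proof -
  have meas: "(\<lambda>t. ennreal (\<mu> t) * indicator {x<..y} t) \<in> borel_measurable lborel"
  proof -
    have "(\<lambda>t. indicator {0<..} t *\<^sub>R \<mu> t) \<in> borel_measurable borel"
      using assms(1) unfolding rate_function_def set_borel_measurable_def by auto
    then have "(\<lambda>t. ennreal (indicator {0<..} t *\<^sub>R \<mu> t) * indicator {x<..y} t) \<in> borel_measurable lborel"
      by measurable
    moreover have "(\<lambda>t. ennreal (indicator {0<..} t *\<^sub>R \<mu> t) * indicator {x<..y} t) =
        (\<lambda>t. ennreal (\<mu> t) * indicator {x<..y} t)"
      using assms(2) by (auto split: split_indicator)
    ultimately show ?thesis by simp
  qed
  have "intensity \<mu> {x<..y} \<noteq> 0"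
  proof
    assume "intensity \<mu> {x<..y} = 0"
    then have "AE t in lborel. ennreal (\<mu> t) * indicator {x<..y} t = 0"
      unfolding intensity_def using meas by (simp add: nn_integral_0_iff_AE)
    moreover have "AE t in lborel. 0 \<le> t \<longrightarrow> 0 < \<mu> t"
      using assms(1) unfolding rate_function_def by auto
    ultimately have "AE t in lborel. t \<notin> {x<..y}"
    proof eventually_elim
      case (elim t)
      then show ?case using assms(2) by (auto split: split_indicator_asm)
    qed
    then have "emeasure lborel {x<..y} = 0"
      by (subst (asm) AE_iff_measurable[of "{x<..y}"]) auto
    then show False using assms(3) by simp
  qed
  then show ?thesis
    using intensity_Ioc_finite[OF assms(1,2)] by (simp add: enn2real_positive_iff zero_less_iff_neq_zero)
qed

lemma poisson_all_and_no_run: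
  fixes e :: "nat \<Rightarrow> real"
  assumes PP: "poisson_process P N \<mu>" and e: "mono e" "0 \<le> e 0"
    and r: "\<And>i. r i = exp (- enn2real (intensity \<mu> {e i<..e (Suc i)}))"
  shows "{\<omega> \<in> space P. (\<forall>i<m. N \<omega> \<inter> {e i<..e (Suc i)} \<noteq> {}) \<and>
            no_run k n (\<lambda>i. N \<omega> \<inter> {e (m + i)<..e (Suc (m + i))} \<noteq> {}) j} \<in> sets P" (is "?E \<in> _")
    and "measure P {\<omega> \<in> space P. (\<forall>i<m. N \<omega> \<inter> {e i<..e (Suc i)} \<noteq> {}) \<and>
            no_run k n (\<lambda>i. N \<omega> \<inter> {e (m + i)<..e (Suc (m + i))} \<noteq> {}) j} =
         (\<Prod>i<m. 1 - r i) * survival k n (\<lambda>i. r (m + i)) j"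
proof -
  interpret prob_space P using PP unfolding poisson_process_def by auto
  let ?A = "\<lambda>i. {e i<..e (Suc i)}"
  have e0: "0 \<le> e i" for i using e monoD[OF e(1), of 0 i] by simp
  have A: "?A i \<in> sets borel" "?A i \<subseteq> {0<..}" "bounded (?A i)" for i
    using e0[of i] by (auto intro: bounded_subset[of "{e i..e (Suc i)}"])
  have disj: "disjoint_family_on ?A I" for I
    unfolding disjoint_family_on_def
  proof (intro ballI impI)
    fix i j :: nat assume "i \<noteq> j"
    then consider "Suc i \<le> j" | "Suc j \<le> i" by linarith
    then show "?A i \<inter> ?A j = {}"
      using monoD[OF e(1), of "Suc i" j] monoD[OF e(1), of "Suc j" i] by cases auto
  qed
  define X where "X = (\<lambda>i \<omega>. card (N \<omega> \<inter> ?A i) \<noteq> 0)"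
  have X: "X i \<omega> \<longleftrightarrow> N \<omega> \<inter> ?A i \<noteq> {}" if "\<omega> \<in> space P" for i \<omega>
  proof -
    have "finite (N \<omega> \<inter> {..e (Suc i)})" using PP that unfolding poisson_process_def by auto
    then have "finite (N \<omega> \<inter> ?A i)" by (rule rev_finite_subset) auto
    then show ?thesis unfolding X_def by simp
  qed
  have "indep_vars (\<lambda>_. count_space UNIV) (\<lambda>i \<omega>. card (N \<omega> \<inter> ?A i)) {..<m + n}"
    using PP[unfolded poisson_process_def, THEN conjunct2, THEN conjunct2, THEN conjunct2,
        rule_format, of "m + n" ?A] A disj by auto
  from indep_vars_compose2[OF this, of "\<lambda>_ c. c \<noteq> 0" "\<lambda>_. count_space UNIV"]
  have ind: "indep_vars (\<lambda>_. count_space UNIV) X {..<m + n}" unfolding X_def by simp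
  have pr: "prob {\<omega> \<in> space P. \<not> X i \<omega>} = r i" for i
  proof -
    have "prob {\<omega> \<in> space P. card (N \<omega> \<inter> ?A i) = 0} =
       enn2real (intensity \<mu> (?A i)) ^ 0 / fact 0 * exp (- enn2real (intensity \<mu> (?A i)))"
      using PP[unfolded poisson_process_def, THEN conjunct2, THEN conjunct2, THEN conjunct1,
          rule_format, of "?A i", THEN conjunct2] A[of i] by auto
    then show ?thesis unfolding X_def r by simp
  qed
  have eq: "?E = {\<omega> \<in> space P. (\<forall>i<m. X i \<omega>) \<and> no_run k n (\<lambda>i. X (m + i) \<omega>) j}"
    using X by (intro Collect_cong conj_cong refl) (simp_all cong: no_run_cong)
  show "?E \<in> events" "prob ?E = (\<Prod>i<m. 1 - r i) * survival k n (\<lambda>i. r (m + i)) j"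
    unfolding eq
    by (rule conjunct1[OF prob_all_and_no_run[OF ind pr]] conjunct2[OF prob_all_and_no_run[OF ind pr]])+
qed

section \<open>Gaps and runs of empty cells\<close>

lemma grid_cell:
  fixes s h x :: real
  assumes "s < x" "x \<le> s + real k * h"
  shows "\<exists>l<k. s + real l * h < x \<and> x \<le> s + real (Suc l) * h"
  using assms(2)
proof (induction k)
  case (Suc k)
  show ?case
  proof (cases "x \<le> s + real k * h")
    case True
    then show ?thesis using Suc.IH less_SucI by blast
  next
    case False
    then show ?thesis using Suc.prems by (intro exI[of _ k]) auto
  qed
qed (use assms(1) in simp)

lemma first_gap_le_if_run:
  fixes t0 h :: real
  assumes fin: "finite (S \<inter> {..t0 + real n * h})" and "0 \<le> t0" "0 < h" "real k * h = 1"
    and run: "\<not> no_run k n (\<lambda>i. S \<inter> {t0 + real i * h<..t0 + real (Suc i) * h} \<noteq> {}) 0"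
  shows "first_gap 1 S \<le> ennreal (t0 + real n * h)"
proof -
  obtain i where i: "i + k \<le> n" "\<forall>l<k. S \<inter> {t0 + real (i + l) * h<..t0 + real (Suc (i + l)) * h} = {}"
    using not_no_run_zero[OF run] by auto
  define u where "u = t0 + real i * h"
  have u: "0 \<le> u" "u \<le> t0 + real n * h" unfolding u_def using assms(2,3) i(1) by auto
  have "S \<inter> {u<..<u + 1} = {}"
  proof (rule ccontr)
    assume "S \<inter> {u<..<u + 1} \<noteq> {}"
    then obtain x where x: "x \<in> S" "u < x" "x < u + 1" by auto
    then obtain l where "l < k" "u + real l * h < x" "x \<le> u + real (Suc l) * h"
      using grid_cell[of u x k h] assms(4) by auto
    then have "l < k" "x \<in> S \<inter> {t0 + real (i + l) * h<..t0 + real (Suc (i + l)) * h}"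
      using x(1) unfolding u_def by (auto simp: algebra_simps)
    then show False using i(2) by blast
  qed
  moreover have "finite (S \<inter> {..u})" by (rule finite_subset[OF _ fin]) (use u in auto)
  ultimately have "first_gap 1 S \<le> ennreal u" using u by (intro first_gap_le) auto
  also have "\<dots> \<le> ennreal (t0 + real n * h)" by (rule ennreal_leI) (rule u)
  finally show ?thesis .
qed

text \<open>
  The occupied cells of length \<open>1/4\<close> take care of the windows that start at or before \<open>t0 - 1/4\<close>. A
  window that starts between \<open>t0 - 1/4\<close> and \<open>t0\<close> contains \<open>(t0, t0 + 1/2]\<close>, which is hit because the grid
  is started as if \<open>k - k div 2\<close> empty cells preceded it, so that the first \<open>k div 2\<close> cells cannot all be
  empty. Any later window contains \<open>k\<close> whole cells.
\<close>
lemma first_gap_ge_if_no_run: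
  fixes h t :: real and m k n :: nat
  defines "t0 \<equiv> real m / 4"
  assumes m: "0 < m" and h: "0 < h" "real (Suc k) * h = 1" and t: "t0 \<le> t" "t + 1 - t0 \<le> real n * h"
    and start: "\<forall>i<m. S \<inter> {real i / 4<..real (Suc i) / 4} \<noteq> {}"
    and nr: "no_run k n (\<lambda>i. S \<inter> {t0 + real i * h<..t0 + real (Suc i) * h} \<noteq> {}) (k - k div 2)"
  shows "ennreal t \<le> first_gap 1 S"
proof (rule first_gap_ge)
  fix u assume u: "0 \<le> u" "u < t"
  show "S \<inter> {u<..<u + 1} \<noteq> {}"
  proof -
    consider "u \<le> t0 - 1/4" | "t0 - 1/4 < u" "u < t0" | "t0 \<le> u" by linarith
    then obtain x where "x \<in> S" "u < x" "x < u + 1"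
    proof cases
      case 1
      define i where "i = nat \<lceil>4 * u\<rceil>"
      have i: "4 * u \<le> real i" "real i < 4 * u + 1" unfolding i_def using u(1) by linarith+
      have "real i < real m" using i 1 unfolding t0_def by simp
      then obtain x where "x \<in> S" "real i / 4 < x" "x \<le> real (Suc i) / 4" using start by fastforce
      then show ?thesis using i by (intro that[of x]) auto
    next
      case 2
      have "1 \<le> real n * h" using t by simp
      then have "real (Suc k) * h \<le> real n * h" using h(2) by simp
      then have "Suc k \<le> n" using h(1) by simp
      then have "k \<le> n + (k - k div 2)" by linarith
      then obtain l where l: "l + (k - k div 2) < k"
          "S \<inter> {t0 + real l * h<..t0 + real (Suc l) * h} \<noteq> {}"
        using no_run_initial[OF nr] by blast
      then obtain x where x: "x \<in> S" "t0 + real l * h < x" "x \<le> t0 + real (Suc l) * h" by auto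
      have "2 * Suc l \<le> Suc k" using l(1) by presburger
      then have "real (2 * Suc l) * h \<le> real (Suc k) * h" using h(1) by (intro mult_right_mono of_nat_mono) auto
      then have "real (Suc l) * h \<le> 1/2" unfolding h(2) by (simp add: algebra_simps)
      moreover have "0 \<le> real l * h" using h(1) by simp
      ultimately show ?thesis using x 2 by (intro that[of x]) linarith+
    next
      case 3
      define i where "i = nat \<lceil>(u - t0) / h\<rceil>"
      have nn: "0 \<le> (u - t0) / h" using 3 h(1) by simp
      have i: "(u - t0) / h \<le> real i" "real i < (u - t0) / h + 1" unfolding i_def using nn by linarith+
      have ih: "u - t0 \<le> real i * h" "real i * h < u - t0 + h"
        using i h(1) by (simp_all add: field_simps)
      have kh: "real k * h = 1 - h" using h(2) by (simp add: algebra_simps)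
      have "real (i + k) * h < real n * h" using ih kh u(2) t(2) by (simp add: algebra_simps)
      then have "i + k \<le> n" using h(1) by simp
      then obtain l where l: "l < k" "S \<inter> {t0 + real (i + l) * h<..t0 + real (Suc (i + l)) * h} \<noteq> {}"
        using no_run_window[OF nr] by blast
      then obtain x where x: "x \<in> S" "t0 + real (i + l) * h < x" "x \<le> t0 + real (Suc (i + l)) * h" by auto
      have "real (Suc (i + l)) * h \<le> real (i + k) * h" using l(1) h(1) by (intro mult_right_mono) auto
      then have "x < u + 1" using x(3) ih kh by (simp add: algebra_simps)
      have "0 \<le> real l * h" using h(1) by simp
      moreover have "real (i + l) * h = real i * h + real l * h" by (simp add: distrib_right)
      ultimately have "u < x" using x(2) ih by linarith
      then show ?thesis using x(1) \<open>x < u + 1\<close> that by blast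
    qed
    then show ?thesis by auto
  qed
qed simp

section \<open>The critical rate and elementary estimates\<close>

definition critical_rate :: "real \<Rightarrow> real \<Rightarrow> real" where
  "critical_rate a t = ln t + ln (ln t) - ln a"

lemma critical_rate_mono: "1 < x \<Longrightarrow> x \<le> y \<Longrightarrow> critical_rate a x \<le> critical_rate a y"
  unfolding critical_rate_def by (intro diff_right_mono add_mono) auto

lemma exp_minus_critical_rate:
  "0 < a \<Longrightarrow> 1 < t \<Longrightarrow> exp (- critical_rate a t) = a / (t * ln t)"
  unfolding critical_rate_def by (simp add: exp_diff exp_add exp_minus ln_div field_simps)

lemma one_minus_exp_ge:
  fixes x :: real
  assumes "0 \<le> x"
  shows "x / (1 + x) \<le> 1 - exp (- x)"
proof -
  have "exp (- x) \<le> 1 / (1 + x)"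
    using exp_ge_add_one_self[of x] assms unfolding exp_minus by (simp add: field_simps)
  then show ?thesis using assms by (simp add: field_simps)
qed

lemma one_minus_ge_exp:
  fixes y \<delta> :: real
  assumes "0 \<le> y" "y \<le> 1 - exp (- \<delta>)"
  shows "exp (- (exp \<delta> * y)) \<le> 1 - y"
proof -
  have pos: "0 < 1 - y" using assms(2) exp_gt_zero[of "- \<delta>"] by linarith
  have "y * exp (- \<delta>) \<le> y * (1 - y)" using assms by (intro mult_left_mono) auto
  then have "y \<le> exp \<delta> * y * (1 - y)" by (simp add: exp_minus field_simps)
  then have "1 \<le> (1 + exp \<delta> * y) * (1 - y)" by (simp add: algebra_simps)
  also have "\<dots> \<le> exp (exp \<delta> * y) * (1 - y)"
    using pos by (intro mult_right_mono) auto
  finally show ?thesis by (simp add: exp_minus field_simps)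
qed

lemma prod_le_exp_telescope:
  fixes f q :: "nat \<Rightarrow> real"
  assumes "\<And>i. i < n \<Longrightarrow> 0 \<le> q i" "\<And>i. i < n \<Longrightarrow> q i \<le> exp (- (b * (f (Suc i) - f i)))"
  shows "(\<Prod>i<n. q i) \<le> exp (- (b * (f n - f 0)))"
proof -
  have "(\<Prod>i<n. q i) \<le> (\<Prod>i<n. exp (- (b * (f (Suc i) - f i))))"
    using assms by (intro prod_mono) auto
  also have "\<dots> = exp (\<Sum>i<n. - (b * (f (Suc i) - f i)))" by (simp add: exp_sum)
  also have "(\<Sum>i<n. - (b * (f (Suc i) - f i))) = - (b * (f n - f 0))"
    unfolding sum_negf by (simp only: sum_distrib_left[symmetric] sum_lessThan_telescope)
  finally show ?thesis .
qed

lemma prod_ge_exp_telescope: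
  fixes f q :: "nat \<Rightarrow> real"
  assumes "\<And>i. i < n \<Longrightarrow> exp (- (b * (f (Suc i) - f i))) \<le> q i"
  shows "exp (- (b * (f n - f 0))) \<le> (\<Prod>i<n. q i)"
proof -
  have "- (b * (f n - f 0)) = (\<Sum>i<n. - (b * (f (Suc i) - f i)))"
    unfolding sum_negf by (simp only: sum_distrib_left[symmetric] sum_lessThan_telescope)
  then have "exp (- (b * (f n - f 0))) = (\<Prod>i<n. exp (- (b * (f (Suc i) - f i))))"
    by (simp only: exp_sum finite_lessThan)
  also have "\<dots> \<le> (\<Prod>i<n. q i)"
    using assms by (intro prod_mono) auto
  finally show ?thesis .
qed

section \<open>The tail of the first gap\<close>

text \<open>
  With \<open>\<rho> i\<close> the probability of an empty cell at the critical rate at the end \<open>x\<close> of the cell,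
  \<open>\<rho> i ^ k = a / (x * ln x)\<close> and \<open>1 - \<rho> i\<close> is at least \<open>h * ln x / (1 + \<epsilon>)\<close> when the mesh is fine enough.
  Each factor in \<open>survival_upper_bound\<close> is therefore at most \<open>1 - b' * h / x\<close>, where \<open>b' = a / (1 + \<epsilon>)\<close>.
  The number \<open>k\<close> of cells per unit length appears as a prefactor; it is of order \<open>ln t\<close>, and the step
  from \<open>b'\<close> down to \<open>b\<close> absorbs it.
\<close>
lemma first_gap_tail_upper:
  fixes \<mu> :: "real \<Rightarrow> real" and a b :: real
  assumes b: "0 < b" "b < a"
    and ev: "\<forall>\<^sub>F t in at_top. \<mu> t \<le> critical_rate a t"
    and PP: "poisson_process P N \<mu>"
  shows "\<exists>C t1. \<forall>t\<ge>t1. \<exists>E\<in>sets P. measure P E \<le> C * t powr (- b) \<and>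
           (\<forall>\<omega>\<in>space P - E. first_gap 1 (N \<omega>) \<le> ennreal t)"
proof -
  let ?m = "critical_rate a"
  \<comment> \<open>The distance from \<open>a\<close> to \<open>b'\<close> pays for the mesh, the one from \<open>b'\<close> to \<open>b\<close> for the prefactor \<open>k\<close>.\<close>
  define b' where "b' = (a + b) / 2"
  have b': "b < b'" "b' < a" "0 < b'" unfolding b'_def using b by auto
  define \<epsilon> where "\<epsilon> = a / b' - 1"
  have \<epsilon>: "0 < \<epsilon>" "a / (1 + \<epsilon>) = b'" unfolding \<epsilon>_def using b' b by (auto simp: field_simps)
  define c where "c = b' - b"
  have c: "0 < c" unfolding c_def using b' by simp
  have "\<forall>\<^sub>F t in at_top. \<mu> t \<le> ?m t \<and> 3 \<le> t \<and> ln a \<le> ln (ln t)"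
    by (intro eventually_conj ev eventually_ge_at_top) real_asymp
  then obtain t0 where t0: "\<And>t. t0 \<le> t \<Longrightarrow> \<mu> t \<le> ?m t \<and> 3 \<le> t \<and> ln a \<le> ln (ln t)"
    unfolding eventually_at_top_linorder by auto
  have ln1: "1 \<le> ln t" if "3 \<le> t" for t :: real
    using ln3_gt_1 that by (smt (verit) ln_mono)
  have m_ge: "ln t \<le> ?m t" "1 \<le> ?m t" if "t0 \<le> t" for t
    using t0[OF that] ln1[of t] unfolding critical_rate_def by auto
  have m_mono: "?m x \<le> ?m y" if "t0 \<le> x" "x \<le> y" for x y
    using t0[of x] that by (intro critical_rate_mono) auto
  define C where "C = ((2 / c + \<bar>ln a\<bar>) / \<epsilon> + 1) * exp (b' * ln (t0 + 1))"
  show ?thesis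
  proof (rule exI[of _ C], rule exI[of _ "t0 + 1"], intro allI impI)
    fix t assume t: "t0 + 1 \<le> t"
    have t3: "3 \<le> t" using t0[of t] t by auto
    define k where "k = nat \<lceil>?m t / \<epsilon>\<rceil>"
    define h where "h = 1 / real k"
    define n where "n = nat \<lfloor>(t - t0) * real k\<rfloor>"
    define \<tau> where "\<tau> = (\<lambda>i. t0 + real i * h)"
    have quot: "0 < ?m t / \<epsilon>" using m_ge(2)[of t] t \<epsilon>(1) by simp
    then have k: "?m t / \<epsilon> \<le> real k" "real k \<le> ?m t / \<epsilon> + 1" unfolding k_def by linarith+
    then have k0: "0 < real k" using quot by linarith
    then have h: "0 < h" "real k * h = 1" unfolding h_def by auto
    have hm: "h * ?m t \<le> \<epsilon>" using k(1) k0 \<epsilon>(1) unfolding h_def by (simp add: field_simps)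
    have "0 \<le> (t - t0) * real k" using t by simp
    then have "real n \<le> (t - t0) * real k" "(t - t0) * real k < real n + 1"
      unfolding n_def by linarith+
    then have "real n * h \<le> (t - t0) * real k * h" "(t - t0) * real k * h \<le> (real n + 1) * h"
      using h(1) by (intro mult_right_mono; simp)+
    moreover have "(t - t0) * real k * h = t - t0" using h(2) by (simp add: mult.assoc)
    ultimately have nh: "\<tau> n \<le> t" "t \<le> \<tau> (Suc n)"
      unfolding \<tau>_def by (simp_all add: algebra_simps)
    have \<tau>_mono: "mono \<tau>" unfolding \<tau>_def using h(1) by (intro monoI) (auto intro!: mult_right_mono)
    have \<tau>0: "\<tau> 0 = t0" unfolding \<tau>_def by simp
    then have \<tau>_ge: "t0 \<le> \<tau> i" for i using monoD[OF \<tau>_mono, of 0 i] by simp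
    have \<tau>_Suc: "\<tau> (Suc i) = \<tau> i + h" for i unfolding \<tau>_def by (simp add: algebra_simps)
    define r where "r = (\<lambda>i. exp (- enn2real (intensity \<mu> {\<tau> i<..\<tau> (Suc i)})))"
    define \<rho> where "\<rho> = (\<lambda>i. exp (- (h * ?m (\<tau> (Suc i)))))"
    have \<rho>_le: "\<rho> i \<le> r i" for i
    proof -
      have "enn2real (intensity \<mu> {\<tau> i<..\<tau> (Suc i)}) \<le> ?m (\<tau> (Suc i)) * (\<tau> (Suc i) - \<tau> i)"
      proof (rule intensity_Ioc_le)
        show "\<tau> i \<le> \<tau> (Suc i)" using \<tau>_Suc h(1) by simp
        show "0 \<le> ?m (\<tau> (Suc i))" using m_ge(2)[OF \<tau>_ge, of "Suc i"] by simp
        fix x assume "\<tau> i < x" "x \<le> \<tau> (Suc i)"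
        then show "\<mu> x \<le> ?m (\<tau> (Suc i))"
          using t0[of x] m_mono[of x "\<tau> (Suc i)"] \<tau>_ge[of i] by auto
      qed
      then show ?thesis unfolding \<rho>_def r_def \<tau>_Suc by (simp add: mult.commute)
    qed
    define E where "E = {\<omega> \<in> space P. no_run k n (\<lambda>i. N \<omega> \<inter> {\<tau> i<..\<tau> (Suc i)} \<noteq> {}) 0}"
    have \<tau>00: "0 \<le> \<tau> 0" unfolding \<tau>0 using t0[of t0] by simp
    have E: "E \<in> sets P" "measure P E = survival k n r 0"
      using poisson_all_and_no_run[OF PP \<tau>_mono \<tau>00, of r 0 k n 0] unfolding E_def r_def by simp_all
    \<comment> \<open>The index is shifted by one so that \<open>h / x\<close> dominates an increment of the logarithm: the
      increment has to be taken to the right of \<open>x\<close>.\<close>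
    have factor: "1 - (1 - \<rho> i) * \<rho> i ^ k \<le> exp (- (b' * (ln (\<tau> (Suc (Suc i))) - ln (\<tau> (Suc i)))))"
      if "i < n" for i
    proof -
      define x where "x = \<tau> (Suc i)"
      have x: "t0 \<le> x" "x \<le> t" "3 \<le> x"
        unfolding x_def using \<tau>_ge monoD[OF \<tau>_mono, of "Suc i" n] that nh(1) t0[OF \<tau>_ge] by auto
      have lx: "0 < ln x" using ln1[OF x(3)] by simp
      have "\<rho> i ^ k = exp (- ?m x)"
        unfolding \<rho>_def x_def exp_of_nat_mult[symmetric] using h(2) by (simp add: mult.assoc[symmetric])
      then have pow: "\<rho> i ^ k = a / (x * ln x)"
        using exp_minus_critical_rate[of a x] b x by simp
      have hx: "0 \<le> h * ?m x" "h * ?m x \<le> \<epsilon>"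
        using m_ge(2)[OF x(1)] h(1) m_mono[OF x(1,2)] hm
        by (auto intro: order_trans[OF mult_left_mono])
      have "h * ln x / (1 + \<epsilon>) \<le> h * ?m x / (1 + h * ?m x)"
      proof (rule frac_le)
        show "h * ln x \<le> h * ?m x" using h(1) m_ge(1)[OF x(1)] by simp
      qed (use hx in linarith)+
      also have "\<dots> \<le> 1 - \<rho> i" unfolding \<rho>_def x_def[symmetric] by (rule one_minus_exp_ge[OF hx(1)])
      finally have "h * ln x / (1 + \<epsilon>) * \<rho> i ^ k \<le> (1 - \<rho> i) * \<rho> i ^ k"
        by (rule mult_right_mono) (simp add: \<rho>_def)
      moreover have "h * ln x / (1 + \<epsilon>) * \<rho> i ^ k = b' * (h / x)"
        unfolding pow \<epsilon>(2)[symmetric] using lx x(3) by (simp add: field_simps)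
      moreover have "ln (\<tau> (Suc (Suc i))) - ln x \<le> h / x"
      proof -
        have pos: "0 < 1 + h / x" using x(3) h(1) by (intro add_pos_pos) auto
        have "\<tau> (Suc (Suc i)) = x * (1 + h / x)"
          unfolding \<tau>_Suc[of "Suc i"] x_def[symmetric] using x(3) by (simp add: field_simps)
        then have "ln (\<tau> (Suc (Suc i))) - ln x = ln (1 + h / x)"
          using pos x(3) by (simp add: ln_mult del: times_divide_eq_right)
        also have "\<dots> \<le> h / x" using x(3) h(1) by (intro ln_add_one_self_le_self) auto
        finally show ?thesis .
      qed
      then have "b' * (ln (\<tau> (Suc (Suc i))) - ln x) \<le> b' * (h / x)"
        using b'(3) by (intro mult_left_mono) auto
      ultimately have "1 - (1 - \<rho> i) * \<rho> i ^ k \<le> 1 + (- (b' * (ln (\<tau> (Suc (Suc i))) - ln x)))" by linarith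
      also have "\<dots> \<le> exp (- (b' * (ln (\<tau> (Suc (Suc i))) - ln x)))" by (rule exp_ge_add_one_self)
      finally show ?thesis unfolding x_def .
    qed
    have \<rho>: "0 \<le> \<rho> i" "\<rho> i \<le> 1" "r i \<le> 1" for i
      unfolding \<rho>_def r_def using m_ge(2)[OF \<tau>_ge, of "Suc i"] h(1) by auto
    have "(\<Prod>i<n. 1 - (1 - \<rho> i) * \<rho> i ^ k) \<le> exp (- (b' * (ln (\<tau> (Suc n)) - ln (\<tau> (Suc 0)))))"
      using factor \<rho> by (intro prod_le_exp_telescope[where f = "\<lambda>i. ln (\<tau> (Suc i))"])
        (auto intro!: mult_le_one simp: power_le_one)
    also have "\<dots> \<le> exp (- (b' * ln t)) * exp (b' * ln (t0 + 1))"
    proof -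
      have "h \<le> 1" using k0 unfolding h_def by simp
      then have "ln (\<tau> (Suc 0)) \<le> ln (t0 + 1)" "ln t \<le> ln (\<tau> (Suc n))"
        using nh(2) t3 \<tau>_Suc[of 0] \<tau>0 h(1) t0[of t0] by auto
      then have "b' * (ln t - ln (t0 + 1)) \<le> b' * (ln (\<tau> (Suc n)) - ln (\<tau> (Suc 0)))"
        using b'(3) by (intro mult_left_mono) auto
      then show ?thesis unfolding exp_add[symmetric] by (simp add: algebra_simps)
    qed
    finally have prod: "(\<Prod>i<n. 1 - (1 - \<rho> i) * \<rho> i ^ k) \<le> exp (b' * ln (t0 + 1)) * t powr (- b')"
      using t3 by (simp add: powr_def mult.commute)
    have k_le: "real k \<le> ((2 / c + \<bar>ln a\<bar>) / \<epsilon> + 1) * t powr c"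
    proof -
      have one: "1 \<le> t powr c" using t3 c by (intro ge_one_powr_ge_zero) auto
      have "ln (ln t) \<le> ln t" using ln1[OF t3] ln_le_minus_one[of "ln t"] by linarith
      then have "?m t \<le> 2 * ln t + \<bar>ln a\<bar>" unfolding critical_rate_def by linarith
      also have "\<dots> \<le> 2 * (t powr c / c) + \<bar>ln a\<bar> * t powr c"
        using ln_powr_bound[of t c] t3 c mult_left_mono[OF one, of "\<bar>ln a\<bar>"] by auto
      finally have "?m t / \<epsilon> + 1 \<le> (2 * (t powr c / c) + \<bar>ln a\<bar> * t powr c) / \<epsilon> + t powr c"
        using \<epsilon>(1) one by (intro add_mono divide_right_mono) auto
      also have "\<dots> = ((2 / c + \<bar>ln a\<bar>) / \<epsilon> + 1) * t powr c" by (simp add: algebra_simps add_divide_distrib)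
      finally show ?thesis using k(2) by linarith
    qed
    have "measure P E \<le> (\<Prod>i<n. 1 - (1 - \<rho> i) * \<rho> i ^ k) * geo (\<rho> 0) (k - 0)"
      unfolding E(2)
    proof (rule survival_upper_bound)
      fix i show "\<rho> (Suc i) \<le> \<rho> i"
        unfolding \<rho>_def using m_mono[OF \<tau>_ge monoD[OF \<tau>_mono], of "Suc i" "Suc (Suc i)"] h(1)
        by (simp add: mult_left_mono)
    qed (use \<rho> \<rho>_le in auto)
    also have "\<dots> \<le> (exp (b' * ln (t0 + 1)) * t powr (- b')) * real k"
      using prod geo_le[OF \<rho>(1,2), of 0 k] geo_nonneg[OF \<rho>(1), of 0 k] by (intro mult_mono) auto
    also have "\<dots> \<le> (exp (b' * ln (t0 + 1)) * t powr (- b')) * (((2 / c + \<bar>ln a\<bar>) / \<epsilon> + 1) * t powr c)"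
      using k_le by (intro mult_left_mono) auto
    also have "\<dots> = C * (t powr (- b') * t powr c)" unfolding C_def by (simp add: algebra_simps)
    also have "t powr (- b') * t powr c = t powr (- b)" unfolding c_def powr_add[symmetric] by simp
    finally have bound: "measure P E \<le> C * t powr (- b)" .
    have gap: "first_gap 1 (N \<omega>) \<le> ennreal t" if "\<omega> \<in> space P - E" for \<omega>
    proof -
      have "finite (N \<omega> \<inter> {..t0 + real n * h})" using PP that unfolding poisson_process_def by auto
      moreover have "0 \<le> t0" using t0[of t0] by simp
      moreover have "\<not> no_run k n (\<lambda>i. N \<omega> \<inter> {t0 + real i * h<..t0 + real (Suc i) * h} \<noteq> {}) 0"
        using that unfolding E_def \<tau>_def by simp
      ultimately have "first_gap 1 (N \<omega>) \<le> ennreal (\<tau> n)"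
        using first_gap_le_if_run[OF _ _ h] unfolding \<tau>_def by blast
      also have "\<dots> \<le> ennreal t" using nh(1) by (rule ennreal_leI)
      finally show ?thesis .
    qed
    show "\<exists>E\<in>sets P. measure P E \<le> C * t powr (- b) \<and>
           (\<forall>\<omega>\<in>space P - E. first_gap 1 (N \<omega>) \<le> ennreal t)"
      using E(1) bound gap by blast
  qed
qed

text \<open>
  These are the demands on the time \<open>t0\<close> at which the grid starts: those of
  \<open>geo_quotient_lower_bound\<close> below, with the constant \<open>4\<close> chosen to make \<open>k div 2\<close> cells, which cover a
  time of at least \<open>1/4\<close>, all empty with probability at most \<open>exp (- 1)\<close>.
\<close>
lemma eventually_tail_lower_conditions:
  fixes a \<delta> :: real
  assumes "0 < a" "0 < \<delta>"
  shows "\<forall>\<^sub>F t in at_top. 3 \<le> t \<and> 4 + \<delta> \<le> critical_rate a t \<and> critical_rate a t \<le> exp \<delta> * ln t \<and>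
      exp \<delta> * a / (t * ln t) \<le> 1 - exp (- \<delta>) \<and>
      a * exp (4 * \<delta>) / t \<le> \<delta> / (1 + \<delta>) \<and> a * exp (4 * \<delta>) / t \<le> 1 - exp (- \<delta>)"
proof (intro eventually_conj eventually_ge_at_top)
  have small: "\<forall>\<^sub>F t in at_top. f t \<le> c" if "(f \<longlongrightarrow> l) at_top" "l < c" for f :: "real \<Rightarrow> real" and l c
    using order_tendstoD(2)[OF that] by eventually_elim simp
  show "\<forall>\<^sub>F t in at_top. 4 + \<delta> \<le> critical_rate a t"
    unfolding critical_rate_def by real_asymp
  have "((\<lambda>t. critical_rate a t / ln t) \<longlongrightarrow> 1) at_top"
    unfolding critical_rate_def by real_asymp
  from small[OF this, of "exp \<delta>"] have "\<forall>\<^sub>F t in at_top. critical_rate a t / ln t \<le> exp \<delta>"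
    using assms by simp
  moreover have "\<forall>\<^sub>F t::real in at_top. 0 < ln t" by real_asymp
  ultimately show "\<forall>\<^sub>F t in at_top. critical_rate a t \<le> exp \<delta> * ln t"
    by eventually_elim (simp add: field_simps)
  have "((\<lambda>t. exp \<delta> * a / (t * ln t)) \<longlongrightarrow> 0) at_top" by real_asymp
  from small[OF this] show "\<forall>\<^sub>F t in at_top. exp \<delta> * a / (t * ln t) \<le> 1 - exp (- \<delta>)"
    using assms by simp
  have *: "((\<lambda>t. a * exp (4 * \<delta>) / t) \<longlongrightarrow> 0) at_top" by real_asymp
  from small[OF *] show "\<forall>\<^sub>F t in at_top. a * exp (4 * \<delta>) / t \<le> \<delta> / (1 + \<delta>)"
    using assms by simp
  from small[OF *] show "\<forall>\<^sub>F t in at_top. a * exp (4 * \<delta>) / t \<le> 1 - exp (- \<delta>)"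
    using assms by simp
qed

text \<open>
  The parameter \<open>s\<close> of the subsolution must exceed the probability \<open>exp (- (h * m))\<close> of an empty cell at
  the critical rate \<open>m\<close>, here by the factor \<open>exp (h * \<delta>)\<close>: this compensates for \<open>q\<close>, because
  \<open>1 - q\<close> is at most \<open>h * a * exp (4 * \<delta>) / x\<close>, which for large \<open>x\<close> is much smaller than \<open>h * \<delta>\<close>.
  The four factors \<open>exp \<delta>\<close> come from \<open>s ^ Suc k\<close>, from passing to \<open>s ^ k\<close>, from comparing the critical rate
  with \<open>ln x\<close>, and from the denominator \<open>1 - s ^ Suc k\<close>; a fifth one turns \<open>1 - y\<close> into an exponential.
\<close>
lemma geo_quotient_lower_bound:
  fixes x h \<delta> a :: real and k :: nat
  defines "s \<equiv> exp (- (h * (critical_rate a x - \<delta>)))"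
  assumes a: "0 < a" and \<delta>: "0 < \<delta>" and h: "0 < h" "real (Suc k) * h = 1"
    and x: "3 \<le> x" "4 + \<delta> \<le> critical_rate a x" "critical_rate a x \<le> exp \<delta> * ln x"
      "exp \<delta> * a / (x * ln x) \<le> 1 - exp (- \<delta>)"
      "a * exp (4 * \<delta>) / x \<le> \<delta> / (1 + \<delta>)" "a * exp (4 * \<delta>) / x \<le> 1 - exp (- \<delta>)"
    and hm: "h * critical_rate a x \<le> \<delta>"
  shows "exp (- (h * critical_rate a x)) \<le> s * (geo s k / geo s (Suc k))"
    and "exp (- (a * exp (5 * \<delta>) * (h / x))) \<le> geo s k / geo s (Suc k)"
proof -
  let ?m = "critical_rate a x"
  have s: "0 < s" "s < 1" unfolding s_def using h(1) x(2) by auto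
  have lx: "0 < ln x" using x(1) by simp
  have h1: "h \<le> 1" using h mult_right_mono[of 1 "real (Suc k)" h] by simp
  define y where "y = s ^ k * (1 - s) / (1 - s ^ Suc k)"
  have sS: "s ^ Suc k = exp \<delta> * a / (x * ln x)"
  proof -
    have "s ^ Suc k = exp (- (real (Suc k) * h * (?m - \<delta>)))"
      unfolding s_def exp_of_nat_mult[symmetric] by (simp add: mult.assoc)
    also have "\<dots> = exp \<delta> * exp (- ?m)" unfolding h(2) exp_add[symmetric] by simp
    finally show ?thesis using exp_minus_critical_rate[of a x] a x(1) by simp
  qed
  have den: "exp (- \<delta>) \<le> 1 - s ^ Suc k" unfolding sS using x(4) by simp
  then have den0: "0 < 1 - s ^ Suc k" using exp_gt_zero[of "- \<delta>"] by linarith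
  have q: "geo s k / geo s (Suc k) = 1 - y"
  proof -
    have "geo s k / geo s (Suc k) = ((1 - s) * geo s k) / ((1 - s) * geo s (Suc k))" using s by simp
    also have "\<dots> = (1 - s ^ k) / (1 - s ^ Suc k)" unfolding geo_mult ..
    also have "\<dots> = 1 - y" unfolding y_def using den0 by (simp add: field_simps)
    finally show ?thesis .
  qed
  have y0: "0 \<le> y" unfolding y_def using s den0 by auto
  define Y where "Y = a * exp (4 * \<delta>) / x"
  have Y0: "0 \<le> Y" unfolding Y_def using a x(1) by simp
  have y_le: "y \<le> h * Y"
  proof -
    have "s * exp (h * (?m - \<delta>)) = 1"
      unfolding s_def using exp_minus_inverse[of "h * (?m - \<delta>)"] by (simp only: mult.commute)
    then have "1 / s = exp (h * (?m - \<delta>))" using s by (simp add: divide_eq_eq mult.commute)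
    also have "\<dots> \<le> exp \<delta>" using hm h(1) \<delta> by (simp add: algebra_simps) (smt (verit) mult_nonneg_nonneg)
    finally have "s ^ Suc k * (1 / s) \<le> s ^ Suc k * exp \<delta>" using s by (intro mult_left_mono) auto
    then have sk: "s ^ k \<le> s ^ Suc k * exp \<delta>" using s by simp
    have "1 - s \<le> h * (?m - \<delta>)"
      unfolding s_def using exp_ge_add_one_self[of "- (h * (?m - \<delta>))"] by linarith
    also have "\<dots> \<le> h * (exp \<delta> * ln x)" using h(1) \<delta> x(3) by (intro mult_left_mono) auto
    finally have s1: "1 - s \<le> h * (exp \<delta> * ln x)" .
    have "y \<le> (s ^ Suc k * exp \<delta>) * (h * (exp \<delta> * ln x)) / exp (- \<delta>)"
      unfolding y_def using s s1 sk den lx h(1) by (intro frac_le mult_mono mult_nonneg_nonneg) auto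
    also have "\<dots> = h * (a * (exp \<delta> * exp \<delta> * exp \<delta> * exp \<delta>) / x)"
      unfolding sS exp_minus using lx x(1) by (simp add: field_simps)
    also have "exp \<delta> * exp \<delta> * exp \<delta> * exp \<delta> = exp (4 * \<delta>)" by (simp add: exp_add[symmetric])
    finally show ?thesis unfolding Y_def .
  qed
  have "y \<le> 1 - exp (- (h * \<delta>))"
  proof -
    have "y \<le> h * (\<delta> / (1 + \<delta>))"
      using y_le x(5) h(1) unfolding Y_def by (intro order_trans[OF y_le mult_left_mono]) (auto simp: Y_def)
    also have "\<dots> \<le> h * \<delta> / (1 + h * \<delta>)"
    proof -
      have "h * \<delta> \<le> 1 * \<delta>" using h1 \<delta> by (intro mult_right_mono) auto
      then have "h * \<delta> / (1 + \<delta>) \<le> h * \<delta> / (1 + h * \<delta>)"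
        using h(1) \<delta> by (intro divide_left_mono) (auto intro!: add_pos_pos mult_pos_pos)
      then show ?thesis by simp
    qed
    also have "\<dots> \<le> 1 - exp (- (h * \<delta>))" using h(1) \<delta> by (intro one_minus_exp_ge) auto
    finally show ?thesis .
  qed
  then have "s * exp (- (h * \<delta>)) \<le> s * (1 - y)" using s by (intro mult_left_mono) auto
  moreover have "s * exp (- (h * \<delta>)) = exp (- (h * ?m))"
    unfolding s_def exp_add[symmetric] by (simp add: algebra_simps)
  ultimately show "exp (- (h * ?m)) \<le> s * (geo s k / geo s (Suc k))" unfolding q by simp
  have "h * Y \<le> Y" using mult_right_mono[OF h1 Y0] by simp
  then have "y \<le> 1 - exp (- \<delta>)" using y_le x(6) unfolding Y_def by linarith
  then have "exp (- (exp \<delta> * y)) \<le> 1 - y" by (rule one_minus_ge_exp[OF y0])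
  moreover have "exp \<delta> * y \<le> exp \<delta> * (h * Y)" using y_le by (intro mult_left_mono) auto
  moreover have "exp \<delta> * (h * Y) = a * exp (5 * \<delta>) * (h / x)"
  proof -
    have "exp (5 * \<delta>) = exp \<delta> * exp (4 * \<delta>)" by (simp add: exp_add[symmetric])
    then show ?thesis unfolding Y_def by simp
  qed
  ultimately show "exp (- (a * exp (5 * \<delta>) * (h / x))) \<le> geo s k / geo s (Suc k)"
    unfolding q by (smt (verit) exp_le_cancel_iff)
qed

text \<open>
  Up to the fixed time \<open>t0\<close> the event requires all cells of length \<open>1/4\<close> to be occupied. This costs a
  factor \<open>\<kappa>\<close> which depends neither on \<open>t\<close> nor on the mesh. Starting the grid with a current run of
  \<open>k - k div 2\<close> cells costs at most another factor \<open>1/2\<close>. The eigenvalues of \<open>survival_lower_bound\<close> are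
  at least \<open>exp (- (b * (h / x)))\<close>, and their product is at least a power of \<open>t\<close> with exponent \<open>- b\<close>.
\<close>
lemma first_gap_tail_lower:
  fixes \<mu> :: "real \<Rightarrow> real" and a b :: real
  assumes b: "0 < a" "a < b" and rf: "rate_function \<mu>"
    and ev: "\<forall>\<^sub>F t in at_top. critical_rate a t \<le> \<mu> t"
    and PP: "poisson_process P N \<mu>"
  shows "\<exists>c>0. \<exists>t1. \<forall>t\<ge>t1. \<exists>E\<in>sets P. c * t powr (- b) \<le> measure P E \<and>
           (\<forall>\<omega>\<in>E. ennreal t \<le> first_gap 1 (N \<omega>))"
proof -
  let ?m = "critical_rate a"
  \<comment> \<open>Five factors \<open>exp \<delta>\<close> are lost in \<open>geo_quotient_lower_bound\<close>.\<close>
  define \<delta> where "\<delta> = ln (b / a) / 5"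
  have \<delta>: "0 < \<delta>" "a * exp (5 * \<delta>) = b" unfolding \<delta>_def using b by auto
  obtain T where T: "\<And>t. T \<le> t \<Longrightarrow> ?m t \<le> \<mu> t \<and> 3 \<le> t \<and> 4 + \<delta> \<le> ?m t \<and> ?m t \<le> exp \<delta> * ln t \<and>
      exp \<delta> * a / (t * ln t) \<le> 1 - exp (- \<delta>) \<and>
      a * exp (4 * \<delta>) / t \<le> \<delta> / (1 + \<delta>) \<and> a * exp (4 * \<delta>) / t \<le> 1 - exp (- \<delta>)"
    using eventually_conj[OF ev eventually_tail_lower_conditions[OF b(1) \<delta>(1)]]
    unfolding eventually_at_top_linorder by blast
  define m where "m = nat \<lceil>4 * T\<rceil>"
  define t0 where "t0 = real m / 4"
  have t0T: "T \<le> t0" unfolding t0_def m_def by linarith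
  have t03: "3 \<le> t0" using T[OF t0T] by blast
  have m0: "0 < m" using t03 unfolding t0_def by (cases m) auto
  have m_mono: "?m x \<le> ?m y" if "t0 \<le> x" "x \<le> y" for x y
    using t03 that by (intro critical_rate_mono) auto
  define \<kappa> where "\<kappa> = (\<Prod>i<m. 1 - exp (- enn2real (intensity \<mu> {real i / 4<..real (Suc i) / 4})))"
  have \<kappa>: "0 < \<kappa>" unfolding \<kappa>_def using intensity_Ioc_pos[OF rf] by (intro prod_pos) auto
  define c where "c = \<kappa> * (1/2) * 2 powr (- b)"
  have "0 < c" unfolding c_def using \<kappa> by simp
  moreover have "\<exists>E\<in>sets P. c * t powr (- b) \<le> measure P E \<and> (\<forall>\<omega>\<in>E. ennreal t \<le> first_gap 1 (N \<omega>))"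
    if t: "t0 \<le> t" for t
  proof -
    \<comment> \<open>The mesh makes \<open>h\<close> times the critical rate at most \<open>\<delta>\<close> up to time \<open>t + 2\<close>, beyond the last cell;
      the summand \<open>2\<close> guarantees \<open>Suc k \<le> 4 * (k div 2)\<close>.\<close>
    define k where "k = nat \<lceil>?m (t + 2) / \<delta>\<rceil> + 2"
    define h where "h = 1 / real (Suc k)"
    define n where "n = nat \<lceil>(t + 1 - t0) * real (Suc k)\<rceil>"
    define \<tau> where "\<tau> = (\<lambda>i. t0 + real i * h)"
    have h: "0 < h" "real (Suc k) * h = 1" unfolding h_def by auto
    have k2: "2 \<le> k" unfolding k_def by simp
    have h1: "h \<le> 1" unfolding h_def by simp
    have "?m (t + 2) / \<delta> \<le> real (Suc k)" unfolding k_def by linarith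
    then have "h * ?m (t + 2) \<le> \<delta>" using \<delta>(1) unfolding h_def by (simp add: field_simps)
    then have hm: "h * ?m x \<le> \<delta>" if "t0 \<le> x" "x \<le> t + 2" for x
      using mult_left_mono[OF m_mono[OF that], of h] h(1) by linarith
    have "0 \<le> (t + 1 - t0) * real (Suc k)" using t by simp
    then have "(t + 1 - t0) * real (Suc k) \<le> real n" "real n \<le> (t + 1 - t0) * real (Suc k) + 1"
      unfolding n_def by linarith+
    then have nn: "(t + 1 - t0) * real (Suc k) * h \<le> real n * h"
       "real n * h \<le> ((t + 1 - t0) * real (Suc k) + 1) * h"
      using h(1) by (intro mult_right_mono; simp)+
    have "(t + 1 - t0) * real (Suc k) * h = t + 1 - t0"
      by (simp only: mult.assoc h(2) mult_1_right)
    then have "t + 1 - t0 \<le> real n * h" "real n * h \<le> t + 1 - t0 + h"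
      using nn by (simp_all only: distrib_right mult_1_left)
    then have nh: "t + 1 - t0 \<le> real n * h" "\<tau> n \<le> t + 2"
      unfolding \<tau>_def using h1 by linarith+
    have \<tau>_mono: "mono \<tau>" unfolding \<tau>_def using h(1) by (intro monoI) (auto intro!: mult_right_mono)
    have \<tau>0: "\<tau> 0 = t0" unfolding \<tau>_def by simp
    then have \<tau>_ge: "t0 \<le> \<tau> i" for i using monoD[OF \<tau>_mono, of 0 i] by simp
    have \<tau>_Suc: "\<tau> (Suc i) = \<tau> i + h" for i unfolding \<tau>_def by (simp add: algebra_simps)
    note cond = T[OF order_trans[OF t0T \<tau>_ge]]
    \<comment> \<open>One increasing sequence of endpoints for the cells of length \<open>1/4\<close> up to \<open>t0 = m / 4\<close> and the grid after it.\<close>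
    define e where "e = (\<lambda>i. if i \<le> m then real i / 4 else \<tau> (i - m))"
    have e_add: "e (m + i) = \<tau> i" for i unfolding e_def using \<tau>0 t0_def by auto
    have e_low: "e i = real i / 4" if "i \<le> m" for i unfolding e_def using that by simp
    have "e i \<le> e (Suc i)" for i
    proof (cases "i < m")
      case True then show ?thesis by (simp add: e_low)
    next
      case False
      then obtain l where "i = m + l" using le_Suc_ex[of m i] by auto
      then show ?thesis using e_add[of l] e_add[of "Suc l"] \<tau>_Suc[of l] h(1) by simp
    qed
    then have e: "mono e" "0 \<le> e 0" using e_low[of 0] by (auto simp: mono_iff_le_Suc)
    define r where "r = (\<lambda>i. exp (- enn2real (intensity \<mu> {e i<..e (Suc i)})))"
    define s where "s = (\<lambda>i. exp (- (h * (?m (\<tau> i) - \<delta>))))"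
    define q where "q = (\<lambda>i. geo (s i) k / geo (s i) (Suc k))"
    define E where "E = {\<omega> \<in> space P. (\<forall>i<m. N \<omega> \<inter> {e i<..e (Suc i)} \<noteq> {}) \<and>
       no_run k n (\<lambda>i. N \<omega> \<inter> {e (m + i)<..e (Suc (m + i))} \<noteq> {}) (k - k div 2)}"
    have E: "E \<in> sets P" "measure P E = (\<Prod>i<m. 1 - r i) * survival k n (\<lambda>i. r (m + i)) (k - k div 2)"
      unfolding E_def
      by (rule poisson_all_and_no_run[OF PP e, of r m k n "k - k div 2"]; simp add: r_def)+
    have quot: "exp (- (h * ?m (\<tau> i))) \<le> s i * q i" "exp (- (b * (h / \<tau> i))) \<le> q i" if "i < n" for i
    proof -
      have "\<tau> i \<le> t + 2" using monoD[OF \<tau>_mono, of i n] that nh(2) by simp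
      note hm' = hm[OF \<tau>_ge this]
      have c: "3 \<le> \<tau> i" "4 + \<delta> \<le> ?m (\<tau> i)" "?m (\<tau> i) \<le> exp \<delta> * ln (\<tau> i)"
        "exp \<delta> * a / (\<tau> i * ln (\<tau> i)) \<le> 1 - exp (- \<delta>)"
        "a * exp (4 * \<delta>) / \<tau> i \<le> \<delta> / (1 + \<delta>)" "a * exp (4 * \<delta>) / \<tau> i \<le> 1 - exp (- \<delta>)"
        using cond[of i] by auto
      show "exp (- (h * ?m (\<tau> i))) \<le> s i * q i" "exp (- (b * (h / \<tau> i))) \<le> q i"
        using geo_quotient_lower_bound[OF b(1) \<delta>(1) h c hm'] unfolding s_def q_def \<delta>(2) by auto
    qed
    have r_le: "r (m + i) \<le> exp (- (h * ?m (\<tau> i)))" for i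
    proof -
      have "?m (\<tau> i) * (\<tau> (Suc i) - \<tau> i) \<le> enn2real (intensity \<mu> {\<tau> i<..\<tau> (Suc i)})"
      proof (rule intensity_Ioc_ge[OF rf])
        show "0 \<le> \<tau> i" "\<tau> i \<le> \<tau> (Suc i)" "0 \<le> ?m (\<tau> i)"
          using cond[of i] \<tau>_Suc[of i] h(1) \<delta>(1) by auto
        fix x assume "\<tau> i < x" "x \<le> \<tau> (Suc i)"
        then show "?m (\<tau> i) \<le> \<mu> x"
          using T[of x] m_mono[of "\<tau> i" x] \<tau>_ge[of i] t0T by auto
      qed
      then show ?thesis
        unfolding r_def using e_add[of i] e_add[of "Suc i"] \<tau>_Suc[of i] by (simp add: mult.commute)
    qed
    have surv_ge: "(\<Prod>i<n. q i) * (geo (s 0) (k - (k - k div 2)) / geo (s 0) k)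
        \<le> survival k n (\<lambda>i. r (m + i)) (k - k div 2)"
      unfolding q_def
    proof (rule survival_lower_bound)
      fix i
      show "s (Suc i) \<le> s i" unfolding s_def
        using m_mono[OF \<tau>_ge monoD[OF \<tau>_mono], of i "Suc i"] h(1) by (simp add: mult_left_mono)
      show "r (m + i) \<le> s i * (geo (s i) k / geo (s i) (Suc k))" if "i < n"
        using r_le[of i] quot(1)[OF that] unfolding q_def by linarith
    qed (use k2 in \<open>auto simp: s_def r_def\<close>)
    have half: "1/2 \<le> geo (s 0) (k - (k - k div 2)) / geo (s 0) k"
    proof -
      have s0: "0 < s 0" "s 0 < 1" unfolding s_def using h(1) cond[of 0] by auto
      have "Suc k \<le> 4 * (k div 2)" using k2 by presburger
      then have "real (Suc k) \<le> 4 * real (k div 2)" by linarith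
      then have "real (Suc k) * h \<le> 4 * real (k div 2) * h" using h(1) by (intro mult_right_mono) auto
      then have "1 \<le> 4 * (real (k div 2) * h)" using h(2) by simp
      then have "1 * 4 \<le> (4 * (real (k div 2) * h)) * (?m (\<tau> 0) - \<delta>)"
        using cond[of 0] by (intro mult_mono) auto
      then have 1: "1 \<le> real (k div 2) * (h * (?m (\<tau> 0) - \<delta>))" by (simp add: mult.assoc)
      have "s 0 ^ (k div 2) = exp (- (real (k div 2) * (h * (?m (\<tau> 0) - \<delta>))))"
        unfolding s_def exp_of_nat_mult[symmetric] by simp
      also have "\<dots> \<le> exp (- 1)" using 1 by simp
      also have "\<dots> \<le> 1/2" using exp_ge_add_one_self[of 1] by (simp add: exp_minus field_simps)
      finally have low: "1/2 \<le> 1 - s 0 ^ (k div 2)" by simp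
      have den: "0 < 1 - s 0 ^ k" using s0 k2 by (simp add: power_less_one_iff)
      have "1/2 * (1 - s 0 ^ k) \<le> (1 - s 0 ^ (k div 2))"
        using low zero_le_power[OF less_imp_le[OF s0(1)], of k] by (simp only: right_diff_distrib)
      then have "1/2 \<le> (1 - s 0 ^ (k div 2)) / (1 - s 0 ^ k)" using den by (simp add: field_simps)
      also have "\<dots> = ((1 - s 0) * geo (s 0) (k div 2)) / ((1 - s 0) * geo (s 0) k)"
        unfolding geo_mult ..
      also have "\<dots> = geo (s 0) (k div 2) / geo (s 0) k" using s0 by simp
      finally show ?thesis by simp
    qed
    have prod_ge: "exp (- (b * ln (t + 2))) \<le> (\<Prod>i<n. q i)"
    proof -
      \<comment> \<open>Now \<open>h / x\<close> must be dominated by an increment of the logarithm, which is taken to the left of \<open>x\<close>.\<close>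
      have f0: "ln (\<tau> (Suc i) - h) - ln (\<tau> i - h) \<ge> h / \<tau> i" for i
      proof -
        have pos: "0 < \<tau> i" "0 < 1 - h / \<tau> i" using cond[of i] h1 by (auto simp: field_simps)
        have "\<tau> i - h = \<tau> i * (1 - h / \<tau> i)" using pos by (simp add: field_simps)
        then have "ln (\<tau> i - h) = ln (\<tau> i) + ln (1 - h / \<tau> i)" using pos by (simp add: ln_mult del: times_divide_eq_right)
        moreover have "ln (1 - h / \<tau> i) \<le> - (h / \<tau> i)" using ln_le_minus_one[OF pos(2)] by simp
        ultimately show ?thesis unfolding \<tau>_Suc by simp
      qed
      have "exp (- (b * (ln (\<tau> n - h) - ln (\<tau> 0 - h)))) \<le> (\<Prod>i<n. q i)"
      proof (rule prod_ge_exp_telescope)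
        fix i assume "i < n"
        have "b * (h / \<tau> i) \<le> b * (ln (\<tau> (Suc i) - h) - ln (\<tau> i - h))"
          using b f0 by (intro mult_left_mono) auto
        then show "exp (- (b * (ln (\<tau> (Suc i) - h) - ln (\<tau> i - h)))) \<le> q i"
          by (intro order_trans[OF _ quot(2)[OF \<open>i < n\<close>]]) simp
      qed
      moreover have "ln (\<tau> n - h) \<le> ln (t + 2)" "0 \<le> ln (\<tau> 0 - h)"
        using nh(2) h1 h(1) cond[of 0] cond[of n] by auto
      then have "b * (ln (\<tau> n - h) - ln (\<tau> 0 - h)) \<le> b * ln (t + 2)"
        using b by (intro mult_left_mono) auto
      ultimately show ?thesis by (smt (verit) exp_le_cancel_iff)
    qed
    have "2 powr (- b) * t powr (- b) \<le> (\<Prod>i<n. q i)"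
    proof -
      have "ln (t + 2) \<le> ln (2 * t)" using t t03 by simp
      then have "b * ln (t + 2) \<le> b * ln (2 * t)" using b by (intro mult_left_mono) auto
      then have "(2 * t) powr (- b) \<le> exp (- (b * ln (t + 2)))" using t t03 by (simp add: powr_def)
      also have "(2 * t) powr (- b) = 2 powr (- b) * t powr (- b)" by (rule powr_mult)
      finally show ?thesis using prod_ge by linarith
    qed
    moreover have "0 \<le> (\<Prod>i<n. q i)" by (rule order_trans[OF exp_ge_zero prod_ge])
    ultimately have "2 powr (- b) * t powr (- b) * (1/2)
        \<le> (\<Prod>i<n. q i) * (geo (s 0) (k - (k - k div 2)) / geo (s 0) k)"
      by (intro mult_mono half) auto
    then have surv: "2 powr (- b) * t powr (- b) * (1/2) \<le> survival k n (\<lambda>i. r (m + i)) (k - k div 2)"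
      using surv_ge by (rule order_trans)
    have "(\<Prod>i<m. 1 - r i) = \<kappa>"
      unfolding \<kappa>_def r_def by (intro prod.cong refl) (simp add: e_low)
    then have "c * t powr (- b) \<le> measure P E"
      unfolding E(2) c_def using mult_left_mono[OF surv, of \<kappa>] \<kappa> by (simp add: mult_ac)
    moreover have "ennreal t \<le> first_gap 1 (N \<omega>)" if "\<omega> \<in> E" for \<omega>
    proof (rule first_gap_ge_if_no_run[OF m0 h])
      show "real m / 4 \<le> t" "t + 1 - real m / 4 \<le> real n * h" using t nh(1) unfolding t0_def by auto
      show "\<forall>i<m. N \<omega> \<inter> {real i / 4<..real (Suc i) / 4} \<noteq> {}"
        using that unfolding E_def by (auto simp: e_low)
      have "e (Suc (m + i)) = \<tau> (Suc i)" for i using e_add[of "Suc i"] by simp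
      then show "no_run k n (\<lambda>i. N \<omega> \<inter> {real m / 4 + real i * h<..real m / 4 + real (Suc i) * h} \<noteq> {}) (k - k div 2)"
        using that unfolding E_def e_add by (simp add: \<tau>_def t0_def)
    qed
    ultimately show ?thesis using E(1) by blast
  qed
  ultimately show ?thesis by blast
qed

section \<open>From the tail to the moments\<close>

lemma ennreal_powr_le:
  assumes "d \<le> ennreal v" "0 \<le> v" "0 < p"
  shows "ennreal_powr d p \<le> ennreal (v powr p)"
proof -
  have "d \<noteq> \<infinity>" using assms(1) by (auto simp: top_unique)
  moreover have "enn2real d \<le> v" using assms by (intro enn2real_leI) auto
  ultimately show ?thesis
    unfolding ennreal_powr_def using assms by (auto intro!: ennreal_leI powr_mono2)
qed

lemma ennreal_powr_ge:
  assumes "ennreal v \<le> d" "0 \<le> v" "0 < p"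
  shows "ennreal (v powr p) \<le> ennreal_powr d p"
proof (cases "d = \<infinity>")
  case False
  then have "v \<le> enn2real d" using enn2real_mono[OF assms(1)] assms(2) by (simp add: top.not_eq_extremum)
  then show ?thesis
    unfolding ennreal_powr_def using assms False by (auto intro!: ennreal_leI powr_mono2)
qed (simp add: ennreal_powr_def)

text \<open>
  For events \<open>E j\<close> the right-hand side is a measurable majorant. If \<open>\<omega>\<close> belongs to all \<open>E j\<close>, which is the only case
  in which \<open>d\<close> may be infinite, the series diverges since its terms are at least \<open>1\<close>. Otherwise \<open>d\<close> is
  bounded through the first \<open>E i\<close> that \<open>\<omega>\<close> avoids, and the term before it, or the constant if \<open>i = 0\<close>,
  suffices.
\<close>
lemma ennreal_powr_le_dyadic_sum:
  assumes p: "0 < p" and out: "\<And>j. \<omega> \<notin> E j \<Longrightarrow> d \<le> ennreal (2 ^ (J + j))"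
  shows "ennreal_powr d p \<le> ennreal ((2 ^ J) powr p) +
           (\<Sum>j. ennreal ((2 ^ (J + Suc j)) powr p) * indicator (E j) \<omega>)" (is "_ \<le> _ + suminf ?f")
proof (cases "\<forall>j. \<omega> \<in> E j")
  case True
  have "of_nat n \<le> suminf ?f" for n
  proof -
    have one: "1 \<le> ?f j" for j
    proof -
      have "(1::real) \<le> 2 ^ (J + Suc j)" by (rule one_le_power) simp
      then have "(1::real) \<le> (2 ^ (J + Suc j)) powr p" using p by (intro ge_one_powr_ge_zero) auto
      then have "ennreal 1 \<le> ennreal ((2 ^ (J + Suc j)) powr p)" by (rule ennreal_leI)
      then show ?thesis using True by simp
    qed
    have "of_nat n = (\<Sum>j<n. 1 :: ennreal)" by simp
    also have "\<dots> \<le> sum ?f {..<n}" by (rule sum_mono) (rule one)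
    also have "\<dots> \<le> suminf ?f" by (rule sum_le_suminf) auto
    finally show ?thesis .
  qed
  note large = this
  have "suminf ?f = \<infinity>"
  proof (rule ccontr)
    assume "suminf ?f \<noteq> \<infinity>"
    then obtain n where "suminf ?f < of_nat n"
      using ennreal_Ex_less_of_nat[of "suminf ?f"] by (auto simp: less_top)
    then show False using large[of n] by simp
  qed
  then show ?thesis by simp
next
  case False
  define i where "i = (LEAST i. \<omega> \<notin> E i)"
  have i: "\<omega> \<notin> E i" unfolding i_def by (rule LeastI_ex) (use False in auto)
  have before: "\<omega> \<in> E j" if "j < i" for j using not_less_Least that unfolding i_def by blast
  have le: "ennreal_powr d p \<le> ennreal ((2 ^ (J + i)) powr p)"
    by (rule ennreal_powr_le[OF out[OF i] _ p]) simp
  show ?thesis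
  proof (cases i)
    case 0
    then show ?thesis using le by (simp add: add_increasing2)
  next
    case (Suc j)
    have "ennreal_powr d p \<le> ?f j" using le before[of j] Suc by simp
    also have "\<dots> \<le> suminf ?f"
    proof -
      have "f j \<le> suminf f" for f :: "nat \<Rightarrow> ennreal" using sum_le_suminf[of f "{j}"] by auto
      then show ?thesis .
    qed
    finally show ?thesis by (simp add: add_increasing)
  qed
qed

lemma moment_finite_if_tail:
  assumes "prob_space P" and p: "0 < p" "p < b"
    and tail: "\<And>t. t1 \<le> t \<Longrightarrow> \<exists>E\<in>sets P. measure P E \<le> C * t powr (- b) \<and>
           (\<forall>\<omega>\<in>space P - E. first_gap l (N \<omega>) \<le> ennreal t)"
  shows "moment_D l P N p < \<infinity>"
proof -
  interpret prob_space P by fact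
  obtain J where J: "t1 \<le> 2 ^ J" using real_arch_pow[of 2 t1] by (auto intro: less_imp_le)
  have "t1 \<le> 2 ^ (J + j)" for j
    using J power_increasing[of J "J + j" "2::real"] by linarith
  then have "\<forall>j. \<exists>E\<in>sets P. measure P E \<le> C * (2 ^ (J + j)) powr (- b) \<and>
           (\<forall>\<omega>\<in>space P - E. first_gap l (N \<omega>) \<le> ennreal (2 ^ (J + j)))"
    using tail by blast
  then obtain E where E: "\<And>j. E j \<in> sets P" "\<And>j. measure P (E j) \<le> C * (2 ^ (J + j)) powr (- b)"
    "\<And>j \<omega>. \<omega> \<in> space P \<Longrightarrow> \<omega> \<notin> E j \<Longrightarrow> first_gap l (N \<omega>) \<le> ennreal (2 ^ (J + j))"
    by (metis Diff_iff)
  let ?w = "\<lambda>j. (2 ^ (J + Suc j)) powr p :: real"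
  let ?f = "\<lambda>j. ?w j * (C * (2 ^ (J + j)) powr (- b))"
  have "moment_D l P N p \<le> (\<integral>\<^sup>+\<omega>. ennreal ((2 ^ J) powr p) + (\<Sum>j. ennreal (?w j) * indicator (E j) \<omega>) \<partial>P)"
    unfolding moment_D_def by (intro nn_integral_mono ennreal_powr_le_dyadic_sum p E(3))
  also have "\<dots> = ennreal ((2 ^ J) powr p) + (\<Sum>j. ennreal (?w j) * emeasure P (E j))"
    using E(1) by (simp add: nn_integral_add nn_integral_suminf nn_integral_cmult_indicator emeasure_space_1)
  also have "\<dots> \<le> ennreal ((2 ^ J) powr p) + (\<Sum>j. ennreal (?f j))"
  proof (intro add_left_mono suminf_le)
    fix j show "ennreal (?w j) * emeasure P (E j) \<le> ennreal (?f j)"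
      unfolding emeasure_eq_measure ennreal_mult[symmetric, OF powr_ge_zero measure_nonneg]
      using E(2)[of j] by (intro ennreal_leI mult_left_mono) auto
  qed auto
  also have "\<dots> < \<infinity>"
  proof -
    have eq: "?f j = (2 ^ Suc J) powr p * C * (2 ^ J) powr (- b) * (2 powr (p - b)) ^ j" for j
    proof -
      have pw: "(2 ^ i) powr x = 2 powr (real i * x)" for i and x :: real
        by (simp add: powr_powr powr_realpow[symmetric])
      have "(2 powr (p - b)) ^ j = 2 powr (real j * (p - b))"
        by (simp add: powr_powr powr_realpow[symmetric] mult.commute)
      then show ?thesis unfolding pw
        by (simp add: powr_add[symmetric] algebra_simps)
    qed
    have "2 powr (p - b) < (1::real)" using p by (simp add: powr_less_one)
    then have "summable ?f" unfolding eq by (intro summable_mult summable_geometric) simp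
    moreover have "0 \<le> ?f j" for j
      by (rule mult_nonneg_nonneg[OF powr_ge_zero order_trans[OF measure_nonneg E(2)[of j]]])
    ultimately have "(\<Sum>j. ennreal (?f j)) \<noteq> top" by (intro ennreal_suminf_neq_top) auto
    then show ?thesis by (simp add: top.not_eq_extremum)
  qed
  finally show ?thesis .
qed

lemma moment_infinite_if_tail:
  assumes "prob_space P" and p: "0 < p" "b < p" and c: "0 < c"
    and tail: "\<And>t. t1 \<le> t \<Longrightarrow> \<exists>E\<in>sets P. c * t powr (- b) \<le> measure P E \<and>
           (\<forall>\<omega>\<in>E. ennreal t \<le> first_gap l (N \<omega>))"
  shows "moment_D l P N p = \<infinity>"
proof -
  interpret prob_space P by fact
  have ge: "ennreal (c * t powr (p - b)) \<le> moment_D l P N p" if t: "t1 \<le> t" "0 \<le> t" for t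
  proof -
    obtain E where E: "E \<in> sets P" "c * t powr (- b) \<le> measure P E"
      "\<And>\<omega>. \<omega> \<in> E \<Longrightarrow> ennreal t \<le> first_gap l (N \<omega>)" using tail[OF t(1)] by blast
    have "c * t powr (p - b) = t powr p * (c * t powr (- b))"
      using powr_add[of t p "- b"] by (simp add: mult_ac)
    also have "\<dots> \<le> t powr p * measure P E" using E(2) by (intro mult_left_mono) auto
    finally have "ennreal (c * t powr (p - b)) \<le> ennreal (t powr p) * emeasure P E"
      unfolding emeasure_eq_measure ennreal_mult[symmetric, OF powr_ge_zero measure_nonneg]
      by (rule ennreal_leI)
    also have "\<dots> = (\<integral>\<^sup>+\<omega>. ennreal (t powr p) * indicator E \<omega> \<partial>P)"
      using E(1) by (simp add: nn_integral_cmult_indicator)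
    also have "\<dots> \<le> moment_D l P N p"
      unfolding moment_D_def using E(3) t(2) p(1)
      by (intro nn_integral_mono) (auto split: split_indicator intro: ennreal_powr_ge)
    finally show ?thesis .
  qed
  show ?thesis
  proof (rule ccontr)
    assume "moment_D l P N p \<noteq> \<infinity>"
    then obtain K where K: "moment_D l P N p = ennreal K" "0 \<le> K" by (cases "moment_D l P N p") auto
    have "filterlim (\<lambda>t. c * t powr (p - b)) at_top at_top" using c p by real_asymp
    then have "\<forall>\<^sub>F t in at_top. K < c * t powr (p - b)" by (simp add: filterlim_at_top_dense)
    then have "\<forall>\<^sub>F t in at_top. K < c * t powr (p - b) \<and> t1 \<le> t \<and> 0 \<le> t"
      by (intro eventually_conj eventually_ge_at_top)
    then obtain t where "K < c * t powr (p - b)" "t1 \<le> t" "0 \<le> t"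
      using eventually_happens'[OF trivial_limit_at_top_linorder] by blast
    then show False using ge[of t] K by (simp add: ennreal_le_iff)
  qed
qed

lemma moment_finite_below_critical:
  assumes "0 < p" "p < a" "poisson_process P N \<mu>"
    and "\<forall>\<^sub>F t in at_top. \<mu> t \<le> critical_rate a t"
  shows "moment_D 1 P N p < \<infinity>"
proof -
  define b where "b = (p + a) / 2"
  have b: "0 < b" "p < b" "b < a" unfolding b_def using assms(1,2) by auto
  obtain C t1 where "\<And>t. t1 \<le> t \<Longrightarrow> \<exists>E\<in>sets P. measure P E \<le> C * t powr (- b) \<and>
           (\<forall>\<omega>\<in>space P - E. first_gap 1 (N \<omega>) \<le> ennreal t)"
    using first_gap_tail_upper[OF b(1,3) assms(4,3)] by blast
  moreover have "prob_space P" using assms(3) unfolding poisson_process_def by blast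
  ultimately show ?thesis using moment_finite_if_tail[OF _ assms(1) b(2)] by blast
qed

lemma moment_infinite_above_critical:
  assumes "0 < a" "a < p" "rate_function \<mu>" "poisson_process P N \<mu>"
    and "\<forall>\<^sub>F t in at_top. critical_rate a t \<le> \<mu> t"
  shows "moment_D 1 P N p = \<infinity>"
proof -
  define b where "b = (p + a) / 2"
  have b: "a < b" "b < p" "0 < p" unfolding b_def using assms(1,2) by auto
  obtain c t1 where "0 < c" "\<And>t. t1 \<le> t \<Longrightarrow> \<exists>E\<in>sets P. c * t powr (- b) \<le> measure P E \<and>
           (\<forall>\<omega>\<in>E. ennreal t \<le> first_gap 1 (N \<omega>))"
    using first_gap_tail_lower[OF assms(1) b(1) assms(3,5,4)] by blast
  moreover have "prob_space P" using assms(4) unfolding poisson_process_def by blast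
  ultimately show ?thesis using moment_infinite_if_tail[OF _ b(3,2)] by blast
qed

theorem corollary5p4:
  fixes \<mu> :: "real \<Rightarrow> real" and a p :: real
  assumes "a > 0" and "p > 0"
    and "rate_function \<mu>"
    and "\<forall>\<^sub>F t in at_top. \<mu> t = ln t + ln (ln t) - ln a"
  shows "(\<forall>(P :: 'w measure) N. poisson_process P N \<mu> \<longrightarrow>
            (p < a \<longrightarrow> moment_D 1 P N p < \<infinity>) \<and>
            (p > a \<longrightarrow> moment_D 1 P N p = \<infinity>)) \<and>
         (\<forall>\<mu>' (P' :: 'v measure) N'. rate_function \<mu>' \<and> poisson_process P' N' \<mu>' \<longrightarrow>
            ((\<forall>\<^sub>F t in at_top. \<mu>' t \<le> \<mu> t) \<and> p < a \<longrightarrow> moment_D 1 P' N' p < \<infinity>) \<and>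
            ((\<forall>\<^sub>F t in at_top. \<mu>' t \<ge> \<mu> t) \<and> p > a \<longrightarrow> moment_D 1 P' N' p = \<infinity>))"
proof -
  have eq: "\<forall>\<^sub>F t in at_top. \<mu> t = critical_rate a t"
    using assms(4) unfolding critical_rate_def .
  have le: "\<forall>\<^sub>F t in at_top. \<nu> t \<le> critical_rate a t" if "\<forall>\<^sub>F t in at_top. \<nu> t \<le> \<mu> t" for \<nu>
    using that eq by eventually_elim simp
  have ge: "\<forall>\<^sub>F t in at_top. critical_rate a t \<le> \<nu> t" if "\<forall>\<^sub>F t in at_top. \<mu> t \<le> \<nu> t" for \<nu>
    using that eq by eventually_elim simp
  have same: "\<forall>\<^sub>F t in at_top. \<mu> t \<le> critical_rate a t" "\<forall>\<^sub>F t in at_top. critical_rate a t \<le> \<mu> t"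
    by (rule le, simp) (rule ge, simp)
  show ?thesis
  proof (intro conjI allI impI; (elim conjE)?)
    fix P :: "'w measure" and N assume PP: "poisson_process P N \<mu>"
    show "moment_D 1 P N p < \<infinity>" if "p < a"
      by (rule moment_finite_below_critical[OF assms(2) that PP same(1)])
    show "moment_D 1 P N p = \<infinity>" if "p > a"
      by (rule moment_infinite_above_critical[OF assms(1) that assms(3) PP same(2)])
  next
    fix \<mu>' and P' :: "'v measure" and N'
    assume rf: "rate_function \<mu>'" and PP: "poisson_process P' N' \<mu>'"
    show "moment_D 1 P' N' p < \<infinity>" if "\<forall>\<^sub>F t in at_top. \<mu>' t \<le> \<mu> t" "p < a"
      by (rule moment_finite_below_critical[OF assms(2) that(2) PP le[OF that(1)]])
    show "moment_D 1 P' N' p = \<infinity>" if "\<forall>\<^sub>F t in at_top. \<mu>' t \<ge> \<mu> t" "p > a"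
      by (rule moment_infinite_above_critical[OF assms(1) that(2) rf PP ge[OF that(1)]])
  qed
qed

end
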